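(* Let $(P_t)_{t\ge 0}$ be a Markov semigroup on a Banach space $E$, let $S=(S_t)_{t\ge0}$ be a subordinator with Bernstein function $\phi$ and Lévy measure $\nu$, and let $(P_t^\phi)_{t\ge0}$ be the subordinate semigroup. Let $\kappa_1>0$, $\kappa_2\in(0,1]$, and suppose that for some $p>1$, $x,e\in E$ and constants $H_1(p,e),H_2(p,e),H_3(p,e)\ge0$ depending on $p$ and $e$, $$\big(P_tf(x)\big)^p\le \big(P_t[f^p(\cdot+e)](x)\big)\exp\Big[\frac{H_1(p,e)}{t^{\kappa_1}}+H_2(p,e)\,t^{\kappa_2}+H_3(p,e)\Big],\qquad t>0,\ 0\le f\in\mathscr B_b(E).$$ Assume that $\liminf_{u\to\infty}\phi(u)u^{-\rho}>0$ for some $\rho\in\big(\kappa_1/(1+\kappa_1),\rho_\infty\big]$, and that for some $r>1$ $$\int_{y\ge1}\exp\Big[\frac{r\,H_2(p,e)}{p-1}\,y^{\kappa_2}\Big]\nu(dy)<\infty .$$ Then there are constants $C_{\kappa_1,\rho,p,r,e},\,C_{\kappa_2,p,r,e}>0$ such that $$\big(P_t^\phi f(x)\big)^p\le \big(P_t^\phi[f^p(\cdot+e)](x)\big)\exp[\Phi(t,p,e)],\qquad t>0,\ 0\le f\in\mathscr B_b(E),$$ where $$\Phi(t,p,e)=\frac{C_{\kappa_1,\rho,p,r,e}}{(t\wedge1)^{\frac{\kappa_1}{\rho-(1-\rho)\kappa_1}}}+C_{\kappa_2,p,r,e}\,(t\vee1)+H_3(p,e).$$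
   Context: A subordinator $S=(S_t)_{t\ge0}$ is an increasing one-dimensional Lévy process started at $0$; its Laplace transform is $\mathbb E\,e^{-uS_t}=e^{-t\phi(u)}$, $u>0$, $t\ge0$, where the Bernstein function $\phi:(0,\infty)\to(0,\infty)$ has the form $\phi(u)=bu+\int_{(0,\infty)}(1-e^{-ux})\,\nu(dx)$ with drift $b\ge0$ and Lévy measure $\nu$ on $(0,\infty)$ satisfying $\int_{(0,\infty)}(x\wedge1)\,\nu(dx)<\infty$. Let $\mu_t=\mathbb P(S_t\in\cdot)$. The subordinate semigroup is $P_t^\phi f=\int_{[0,\infty)}P_sf\,\mu_t(ds)$ for bounded measurable $f$. $\mathscr B_b(E)$ denotes the bounded Borel measurable real functions on $E$; $P_t[f^p(\cdot+e)](x)$ means $P_t$ applied to the function $y\mapsto f(y+e)^p$, evaluated at $x$. Index: $\rho_\infty:=\sup\{\alpha:\liminf_{u\to\infty}\phi(u)u^{-\alpha}>0\}\in[0,1]$. Constants with subscripts depend on the listed parameters (dependence on $e$ and $p$ includes dependence on the values $H_i(p,e)$) and on the subordinator, i.e. on $\phi$, but not on $t$ or $f$. Notation: $a\wedge b=\min\{a,b\}$, $a\vee b=\max\{a,b\}$. *)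

theory Defs
  imports "HOL-Probability.Probability"
begin

definition bounded_borel :: "('a::topological_space \<Rightarrow> real) set" where
  "bounded_borel = {f \<in> borel_measurable borel. bounded (range f)}"

(* The semigroup acts on bounded Borel functions only; values of P t on other functions and at
   negative times are irrelevant. Semigroups P t f x = (\<integral>y. f y \<partial>K t x) given by Markov transition
   kernels K are a special case. Measurability in time is what gives the integral defining the
   subordinate semigroup a meaning. *)
locale markov_semigroup =
  fixes P :: "real \<Rightarrow> ('a::banach \<Rightarrow> real) \<Rightarrow> 'a \<Rightarrow> real"
  assumes closed: "0 \<le> t \<Longrightarrow> f \<in> bounded_borel \<Longrightarrow> P t f \<in> bounded_borel"
    and linear: "0 \<le> t \<Longrightarrow> f \<in> bounded_borel \<Longrightarrow> g \<in> bounded_borel \<Longrightarrow>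
      P t (\<lambda>y. a * f y + c * g y) = (\<lambda>y. a * P t f y + c * P t g y)"
    and positive: "0 \<le> t \<Longrightarrow> f \<in> bounded_borel \<Longrightarrow> (\<And>y. 0 \<le> f y) \<Longrightarrow> 0 \<le> P t f x"
    and unital: "0 \<le> t \<Longrightarrow> P t (\<lambda>_. 1) = (\<lambda>_. 1)"
    and at_zero: "f \<in> bounded_borel \<Longrightarrow> P 0 f = f"
    and semigroup: "0 \<le> s \<Longrightarrow> 0 \<le> t \<Longrightarrow> f \<in> bounded_borel \<Longrightarrow> P (s + t) f = P s (P t f)"
    and time_measurable: "f \<in> bounded_borel \<Longrightarrow> set_borel_measurable borel {0..} (\<lambda>s. P s f x)"

(* Path regularity is imposed only through stochastic continuity; a process with stationary
   increments and cadlag paths is automatically stochastically continuous. *)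
locale levy_process = prob_space M for M :: "'w measure" +
  fixes X :: "real \<Rightarrow> 'w \<Rightarrow> real"
  assumes random_variable: "0 \<le> t \<Longrightarrow> X t \<in> borel_measurable M"
    and start: "AE \<omega> in M. X 0 \<omega> = 0"
    and independent_increments:
      "0 \<le> \<tau> 0 \<Longrightarrow> (\<And>i. i < n \<Longrightarrow> \<tau> i < \<tau> (Suc i)) \<Longrightarrow>
        indep_vars (\<lambda>_. borel) (\<lambda>i \<omega>. X (\<tau> (Suc i)) \<omega> - X (\<tau> i) \<omega>) {..<n::nat}"
    and stationary_increments:
      "0 \<le> s \<Longrightarrow> 0 \<le> h \<Longrightarrow> distr M borel (\<lambda>\<omega>. X (s + h) \<omega> - X s \<omega>) = distr M borel (X h)"
    and stochastically_continuous:
      "0 \<le> s \<Longrightarrow> 0 < \<epsilon> \<Longrightarrow>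
        ((\<lambda>t. prob {\<omega> \<in> space M. \<epsilon> < \<bar>X t \<omega> - X s \<omega>\<bar>}) \<longlongrightarrow> 0) (at s within {0..})"

locale subordinator = levy_process M S for M :: "'w measure" and S +
  assumes increasing: "AE \<omega> in M. \<forall>s t. 0 \<le> s \<longrightarrow> s \<le> t \<longrightarrow> S s \<omega> \<le> S t \<omega>"

definition laplace_exponent :: "'w measure \<Rightarrow> (real \<Rightarrow> 'w \<Rightarrow> real) \<Rightarrow> (real \<Rightarrow> real) \<Rightarrow> bool" where
  "laplace_exponent M S \<phi> \<longleftrightarrow>
    (\<forall>t\<ge>0. \<forall>u>0. (\<integral>\<omega>. exp (- u * S t \<omega>) \<partial>M) = exp (- t * \<phi> u))"

(* b is the drift and \<nu> the Levy measure, regarded as a Borel measure on the whole real line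
   carried by the open half-line. *)
definition bernstein_function :: "(real \<Rightarrow> real) \<Rightarrow> real \<Rightarrow> real measure \<Rightarrow> bool" where
  "bernstein_function \<phi> b \<nu> \<longleftrightarrow>
    0 \<le> b \<and> sets \<nu> = sets borel \<and> emeasure \<nu> {..0} = 0 \<and>
    (\<integral>\<^sup>+y. ennreal (min y 1) \<partial>\<nu>) < \<infinity> \<and>
    (\<forall>u>0. 0 < \<phi> u \<and> \<phi> u = b * u + (\<integral>y. 1 - exp (- u * y) \<partial>\<nu>))"

(* The supremum may be taken in the reals: for a Bernstein function the set contains every
   negative exponent and is bounded above by 1. *)
definition rho_infty :: "(real \<Rightarrow> real) \<Rightarrow> real" where
  "rho_infty \<phi> = Sup {\<alpha>. 0 < Liminf at_top (\<lambda>u. ereal (\<phi> u * u powr (- \<alpha>)))}"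

definition subordinate ::
  "'w measure \<Rightarrow> (real \<Rightarrow> 'w \<Rightarrow> real) \<Rightarrow> (real \<Rightarrow> ('a \<Rightarrow> real) \<Rightarrow> 'a \<Rightarrow> real) \<Rightarrow>
    real \<Rightarrow> ('a \<Rightarrow> real) \<Rightarrow> 'a \<Rightarrow> real" where
  "subordinate M S P t f x = (LINT s:{0..}|distr M borel (S t). P s f x)"

definition shift_harnack ::
  "(real \<Rightarrow> ('a::banach \<Rightarrow> real) \<Rightarrow> 'a \<Rightarrow> real) \<Rightarrow> real \<Rightarrow> 'a \<Rightarrow> 'a \<Rightarrow> (real \<Rightarrow> real) \<Rightarrow> bool" where
  "shift_harnack Q p x e \<Psi> \<longleftrightarrow>
    (\<forall>t>0. \<forall>f\<in>bounded_borel. (\<forall>y. 0 \<le> f y) \<longrightarrow>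
      (Q t f x) powr p \<le> Q t (\<lambda>y. f (y + e) powr p) x * exp (\<Psi> t))"

end

theory Submission
  imports Defs
begin

text \<open>
  Integrating the Harnack inequality of \<open>P\<close> against the law of \<open>S t\<close> and applying the Hoelder
  inequality leaves the factor \<open>(E exp (\<Psi> (S t) / (p - 1))) powr (p - 1)\<close>, so that an exponential moment
  of \<open>S t powr (- \<kappa>1)\<close> and one of \<open>S t powr \<kappa>2\<close> have to be bounded. Only the Laplace transforms
  \<open>exp (- t * \<phi> u)\<close> of the laws enter.

  For the first, \<open>exp (c * s powr (- \<kappa>))\<close> is dominated by a series of exponentials
  \<open>exp ((c + 1) * n powr (\<kappa> / (1 + \<kappa>)) - n * s)\<close>, whose expectations \<open>\<phi> n \<ge> c' * n powr \<rho>\<close> controls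
  as \<open>\<rho> > \<kappa> / (1 + \<kappa>)\<close>; Young's inequality produces the exponent in \<open>t\<close>.

  For the second, a submultiplicative function \<open>F = exp g\<close> satisfies \<open>A F \<le> C * F\<close>, where \<open>A\<close> is the
  generator of the subordinator, and the Gronwall inequality gives \<open>E F (S t) \<le> exp (C * t)\<close>. The action
  of \<open>A\<close> is known from the Laplace transform on polynomials in \<open>exp (- s / N)\<close> only; these approximate
  \<open>exp (g (N * (1 - exp (- s / N))))\<close> in the \<open>C\<^sup>1\<close> sense, and \<open>N\<close> tends to infinity by Fatou's lemma.
\<close>

subsection \<open>Real inequalities\<close>

text \<open>For fixed \<open>b\<close> the difference \<open>f\<close> is nonincreasing in
  \<open>a\<close>, because \<kappa> \<le> 1, so it is largest at 0. The statement says that y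
  \<mapsto> (1 + y) powr \<kappa> - 1 is subadditive.\<close>

lemma powr_shift_subadditive:
  fixes a b \<kappa> :: real
  assumes "0 \<le> \<kappa>" "\<kappa> \<le> 1" "0 \<le> a" "0 \<le> b"
  shows "(1 + (a + b)) powr \<kappa> \<le> (1 + a) powr \<kappa> + (1 + b) powr \<kappa> - 1"
proof -
  define f where "f = (\<lambda>a. (1 + (a + b)) powr \<kappa> - (1 + a) powr \<kappa>)"
  have "f a \<le> f 0"
  proof (rule DERIV_nonpos_imp_nonincreasing[OF \<open>0 \<le> a\<close>])
    fix x assume x: "0 \<le> x" "x \<le> a"
    have "(f has_real_derivative \<kappa> * (1 + (x + b)) powr (\<kappa> - 1) - \<kappa> * (1 + x) powr (\<kappa> - 1)) (at x)"
      unfolding f_def using x assms by (auto intro!: derivative_eq_intros)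
    moreover have "(1 + (x + b)) powr (\<kappa> - 1) \<le> (1 + x) powr (\<kappa> - 1)"
      using x assms by (intro powr_mono2') auto
    ultimately show "\<exists>y. (f has_real_derivative y) (at x) \<and> y \<le> 0"
      using assms(1) by (metis diff_le_0_iff_le mult_left_mono)
  qed
  then show ?thesis by (simp add: f_def)
qed

text \<open>The weights 1 / (1 + y) and y / (1 + y) sum to 1, and x \<le> x powr \<kappa> holds on
  (0, 1].\<close>

lemma powr_one_plus_le:
  fixes y \<kappa> :: real
  assumes "0 \<le> \<kappa>" "\<kappa> \<le> 1" "0 \<le> y"
  shows "(1 + y) powr \<kappa> \<le> 1 + y powr \<kappa>"
proof (cases "y = 0")
  case False
  have le: "x \<le> x powr \<kappa>" if "0 < x" "x \<le> 1" for x :: real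
    using powr_mono'[of \<kappa> 1 x] that assms by simp
  have "(1 + y) powr \<kappa> = (1 + y) powr \<kappa> * (1 / (1 + y) + y / (1 + y))"
    using assms by (simp add: field_simps)
  also have "\<dots> \<le> (1 + y) powr \<kappa> * ((1 / (1 + y)) powr \<kappa> + (y / (1 + y)) powr \<kappa>)"
    using assms False by (intro mult_left_mono add_mono le) (auto simp: field_simps)
  also have "\<dots> = 1 + y powr \<kappa>"
    using assms False by (simp add: powr_divide field_simps)
  finally show ?thesis .
qed (use assms in auto)

lemma exp_minus_one_le:
  fixes x :: real
  shows "exp x - 1 \<le> x * exp x"
proof -
  have "1 + (- x) \<le> exp (- x)" by (rule exp_ge_add_one_self)
  then have "(1 - x) * exp x \<le> exp (- x) * exp x" by (intro mult_right_mono) auto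
  then show ?thesis by (simp add: algebra_simps flip: exp_add)
qed

lemma exp_minus_le_power:
  fixes x :: real
  assumes "0 < x"
  shows "exp (- x) \<le> fact n / x ^ n"
proof -
  have "x ^ n / fact n \<le> exp x"
    using sum_le_suminf[OF summable_exp[of x], of "{n}"] assms
    by (simp add: exp_def field_simps)
  then show ?thesis using assms by (simp add: exp_minus field_simps)
qed

text \<open>Integrating a polynomial approximation of the derivative keeps the value at \<open>1\<close> exact.\<close>

lemma polynomial_approx_C1:
  fixes Q Q' :: "real \<Rightarrow> real"
  assumes "\<And>x. x \<in> {0..1} \<Longrightarrow> (Q has_real_derivative Q' x) (at x within {0..1})"
    and "continuous_on {0..1} Q'" and "0 < \<epsilon>"
  obtains a n where "(\<Sum>i\<le>n. a i) = Q 1"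
    and "\<And>x y. 0 \<le> x \<Longrightarrow> x \<le> y \<Longrightarrow> y \<le> 1 \<Longrightarrow>
      \<bar>((\<Sum>i\<le>n. a i * y ^ i) - Q y) - ((\<Sum>i\<le>n. a i * x ^ i) - Q x)\<bar> \<le> \<epsilon> * (y - x)"
    and "\<And>x. x \<in> {0..1} \<Longrightarrow> \<bar>(\<Sum>i\<le>n. a i * real i * x ^ i) - x * Q' x\<bar> \<le> \<epsilon>"
proof -
  obtain h where h: "real_polynomial_function h" and hQ: "\<And>x. x \<in> {0..1} \<Longrightarrow> \<bar>Q' x - h x\<bar> < \<epsilon>"
    using Stone_Weierstrass_real_polynomial_function[OF compact_Icc assms(2,3)] by blast
  obtain c m where hc: "h = (\<lambda>x. \<Sum>i\<le>m. c i * x ^ i)"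
    using h real_polynomial_function_iff_sum by blast
  \<comment> \<open>Coefficients of an antiderivative of \<open>h\<close>, with the constant term
    fitted so that they sum to Q 1.\<close>
  define d where "d i = (case i of 0 \<Rightarrow> Q 1 - (\<Sum>i\<le>m. c i / real (Suc i)) | Suc j \<Rightarrow> c j / real (Suc j))" for i
  define p where "p x = (\<Sum>i\<le>Suc m. d i * x ^ i)" for x
  have p_eq: "p x = d 0 + (\<Sum>i\<le>m. c i / real (Suc i) * x ^ Suc i)" for x
    unfolding p_def sum.atMost_Suc_shift by (simp add: d_def)
  have sum1: "(\<Sum>i\<le>Suc m. d i) = Q 1"
    unfolding sum.atMost_Suc_shift by (simp add: d_def)
  have p_deriv: "(p has_real_derivative h x) (at x within A)" for x A
  proof -
    have "((\<lambda>x. d 0 + (\<Sum>i\<le>m. c i / real (Suc i) * x ^ Suc i)) has_real_derivative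
        0 + (\<Sum>i\<le>m. c i / real (Suc i) * (real (Suc i) * x ^ i))) (at x within A)"
      by (intro DERIV_add DERIV_const DERIV_sum DERIV_cmult)
         (use DERIV_power_Suc[OF DERIV_ident] in \<open>simp add: mult.commute\<close>)
    also have "0 + (\<Sum>i\<le>m. c i / real (Suc i) * (real (Suc i) * x ^ i)) = h x"
      by (simp add: hc)
    finally show ?thesis unfolding p_eq[abs_def] .
  qed
  \<comment> \<open>The operator x p'(x) multiplies the i-th coefficient by i; the drift part of the
    generator has this form.\<close>
  have xh: "(\<Sum>i\<le>Suc m. d i * real i * x ^ i) = x * h x" for x
    unfolding sum.atMost_Suc_shift by (simp add: d_def hc sum_distrib_left ac_simps)
  show ?thesis
  proof
    show "(\<Sum>i\<le>Suc m. d i) = Q 1" by (rule sum1)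
    fix x :: real assume x: "x \<in> {0..1}"
    have "\<bar>x * h x - x * Q' x\<bar> = x * \<bar>Q' x - h x\<bar>"
      using x by (simp add: abs_mult abs_minus_commute flip: right_diff_distrib)
    also have "\<dots> \<le> 1 * \<epsilon>" using x hQ[OF x] by (intro mult_mono) auto
    finally show "\<bar>(\<Sum>i\<le>Suc m. d i * real i * x ^ i) - x * Q' x\<bar> \<le> \<epsilon>"
      unfolding xh by simp
  next
    fix x y :: real assume xy: "0 \<le> x" "x \<le> y" "y \<le> 1"
    \<comment> \<open>The error p - Q has derivative h - Q', bounded by \<epsilon>, so its
      increments are small relative to y - x.\<close>
    have "norm ((p y - Q y) - (p x - Q x)) \<le> \<epsilon> * norm (y - x)"
    proof (rule field_differentiable_bound[of "{0..1}"])
      show "((\<lambda>z. p z - Q z) has_field_derivative h z - Q' z) (at z within {0..1})" if "z \<in> {0..1}" for z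
        using that by (intro DERIV_diff p_deriv assms(1))
      show "norm (h z - Q' z) \<le> \<epsilon>" if "z \<in> {0..1}" for z
        using hQ[OF that] by (simp add: abs_minus_commute)
    qed (use xy in auto)
    then show "\<bar>((\<Sum>i\<le>Suc m. d i * y ^ i) - Q y) - ((\<Sum>i\<le>Suc m. d i * x ^ i) - Q x)\<bar> \<le> \<epsilon> * (y - x)"
      using xy by (simp add: p_def)
  qed
qed

text \<open>Dominates the integrand of the Levy-Khintchine formula by a multiple of
  \<open>min y 1\<close>, which \<nu> integrates.\<close>

lemma one_minus_exp_le_min:
  fixes u y :: real
  assumes "0 \<le> u" "0 \<le> y"
  shows "0 \<le> 1 - exp (- u * y)" "1 - exp (- u * y) \<le> max u 1 * min y 1"
proof -
  show "0 \<le> 1 - exp (- u * y)" using assms by simp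
  have "1 - exp (- u * y) \<le> u * y" using exp_ge_add_one_self[of "- u * y"] by simp
  also have "u * y \<le> max u 1 * y" using assms by (intro mult_right_mono) auto
  finally have "1 - exp (- u * y) \<le> max u 1 * y" .
  moreover have "1 - exp (- u * y) \<le> max u 1 * 1"
    using exp_gt_zero[of "- u * y"] by linarith
  ultimately show "1 - exp (- u * y) \<le> max u 1 * min y 1" by (simp add: min_def)
qed

text \<open>These are the difference quotients at 0 of h \<mapsto> 1 - exp (- s h), taken along h =
  1 / (k + 1).\<close>

lemma LIMSEQ_scaled_one_minus_exp:
  fixes s :: real
  shows "(\<lambda>k. real (Suc k) * (1 - exp (- s / real (Suc k)))) \<longlonglongrightarrow> s"
proof -
  have "((\<lambda>u. 1 - exp (- s * u)) has_real_derivative s) (at 0)"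
    by (auto intro!: derivative_eq_intros)
  then have "(\<lambda>h. (1 - exp (- s * h)) / h) \<midarrow>0\<rightarrow> s"
    by (simp add: has_field_derivative_iff)
  moreover have "filterlim (\<lambda>k. inverse (real (Suc k))) (at 0) sequentially"
    unfolding filterlim_at using LIMSEQ_inverse_real_of_nat by auto
  ultimately have "(\<lambda>k. (1 - exp (- s * inverse (real (Suc k)))) / inverse (real (Suc k))) \<longlonglongrightarrow> s"
    by (rule filterlim_compose)
  then show ?thesis by (simp add: divide_inverse mult.commute del: of_nat_Suc)
qed

text \<open>According to which of u and (r - 1) v is larger, u + v is at most one of the two
  exponents on the right. This separates the negative from the positive power of time and leaves the
  factor r on the latter.\<close>

lemma exp_add_le_conjugate:
  fixes u v r :: real
  assumes "1 < r"
  shows "exp (u + v) \<le> exp (r / (r - 1) * u) + exp (r * v)"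
proof (cases "u \<le> (r - 1) * v")
  case True
  then have "exp (u + v) \<le> exp (r * v)" by (simp add: algebra_simps)
  then show ?thesis by (simp add: add_increasing)
next
  case False
  then have "u + v \<le> r / (r - 1) * u" using assms by (simp add: field_simps)
  then have "exp (u + v) \<le> exp (r / (r - 1) * u)" by simp
  then show ?thesis by (simp add: add_increasing2)
qed

section \<open>Series of exponentials that dominate negative powers\<close>

text \<open>Half of the decay \<tau> c N powr \<rho> absorbs a N powr \<theta> up to a multiple of
  \<tau> powr (- \<gamma>). The other half makes the series converge at the cost of a power of 1 /
  \<tau>, which the exponential of \<tau> powr (- \<gamma>) absorbs too.\<close>

lemma exp_minus_rate_sum_bound:
  fixes a c \<theta> \<rho> :: real
  assumes "0 \<le> a" "0 < c" "0 < \<theta>" "\<theta> < \<rho>"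
  obtains C where "0 < C"
    and "\<And>\<tau>. 0 < \<tau> \<Longrightarrow> \<tau> \<le> 1 \<Longrightarrow>
      (\<Sum>n. ennreal (exp (a * real (Suc n) powr \<theta> - \<tau> * c * real (Suc n) powr \<rho>)))
        \<le> ennreal (exp (C * \<tau> powr (- (\<theta> / (\<rho> - \<theta>)))))"
proof -
  define \<gamma> where "\<gamma> = \<theta> / (\<rho> - \<theta>)"
  define D where "D = a * (2 * a / c) powr \<gamma>"
  \<comment> \<open>Chosen so that (N powr \<rho>) ^ m is at least N ^ 2, whose reciprocals are
    summable.\<close>
  define m where "m = nat \<lceil>2 / \<rho>\<rceil>"
  define B where "B = fact m / (c / 2) ^ m"
  define Z where "Z = (\<Sum>n. 1 / real (Suc n) ^ 2)"
  have \<gamma>: "0 < \<gamma>" using assms by (simp add: \<gamma>_def)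
  have D: "0 \<le> D" using assms by (simp add: D_def)
  have B: "0 \<le> B" using assms by (simp add: B_def)
  have m: "2 \<le> \<rho> * real m"
  proof -
    have "2 / \<rho> \<le> real m" unfolding m_def by linarith
    then show ?thesis using assms by (simp add: field_simps)
  qed
  have sumZ: "summable (\<lambda>n. 1 / real (Suc n) ^ 2)"
    using inverse_squares_sums by (simp add: sums_iff)
  have Z: "0 \<le> Z" unfolding Z_def by (intro suminf_nonneg sumZ) auto
  show ?thesis
  proof (rule that[of "D + real m / \<gamma> + B * Z + 1"])
    show "0 < D + real m / \<gamma> + B * Z + 1" using \<gamma> D B Z by (simp add: add_nonneg_pos)
    fix \<tau> :: real assume \<tau>: "0 < \<tau>" "\<tau> \<le> 1"
    define T where "T = \<tau> powr (- \<gamma>)"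
    have T1: "1 \<le> T"
      using powr_mono'[of "-\<gamma>" 0 \<tau>] \<tau> \<gamma> by (simp add: T_def)
    have summand: "exp (a * N powr \<theta> - \<tau> * c * N powr \<rho>) \<le> exp (D * T) * (B / \<tau> ^ m) * (1 / N ^ 2)"
      if N: "1 \<le> N" for N :: real
    proof -
      have "a * N powr \<theta> - \<tau> * c * N powr \<rho> \<le> D * T - \<tau> * c / 2 * N powr \<rho>"
      proof (cases "a * N powr \<theta> \<le> \<tau> * c / 2 * N powr \<rho>")
        case True
        moreover have "0 \<le> D * T" using D T1 by simp
        ultimately show ?thesis by simp
      next
        case False
        then have "\<tau> * c * N powr \<rho> < 2 * a * N powr \<theta>" by simp
        \<comment> \<open>If half of the decay does not suffice, then N is bounded; raising to the
          power \<gamma> turns the exponent \<rho> - \<theta> into \<theta>.\<close>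
        then have "N powr (\<rho> - \<theta>) \<le> 2 * a / (\<tau> * c)"
          using \<tau> assms N by (simp add: powr_diff field_simps)
        then have "(N powr (\<rho> - \<theta>)) powr \<gamma> \<le> (2 * a / (\<tau> * c)) powr \<gamma>"
          using \<gamma> by (intro powr_mono2) auto
        also have "(N powr (\<rho> - \<theta>)) powr \<gamma> = N powr \<theta>"
          using assms by (simp add: powr_powr \<gamma>_def)
        also have "(2 * a / (\<tau> * c)) powr \<gamma> = (2 * a / c) powr \<gamma> * T"
          using assms \<tau> by (simp add: T_def powr_minus powr_mult powr_divide field_simps)
        finally have "a * N powr \<theta> \<le> D * T"
          using assms by (simp add: D_def mult.assoc mult_left_mono)
        moreover have "0 \<le> \<tau> * c * N powr \<rho>" using \<tau> assms by simp
        ultimately show ?thesis by simp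
      qed
      then have "exp (a * N powr \<theta> - \<tau> * c * N powr \<rho>) \<le> exp (D * T) * exp (- (\<tau> * c / 2 * N powr \<rho>))"
        by (simp flip: exp_add)
      also have "exp (- (\<tau> * c / 2 * N powr \<rho>)) \<le> fact m / (\<tau> * c / 2 * N powr \<rho>) ^ m"
        using \<tau> assms N by (intro exp_minus_le_power) auto
      also have "\<dots> = B / \<tau> ^ m * (1 / (N powr \<rho>) ^ m)"
        by (simp add: B_def power_mult_distrib power_divide)
      also have "\<dots> \<le> B / \<tau> ^ m * (1 / N ^ 2)"
      proof -
        have "N ^ 2 = N powr 2" using N by simp
        also have "\<dots> \<le> N powr (\<rho> * real m)" using N m by (intro powr_mono) auto
        also have "\<dots> = (N powr \<rho>) ^ m" using N by (simp add: powr_powr flip: powr_realpow)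
        finally show ?thesis using B \<tau> N by (intro mult_left_mono divide_left_mono) auto
      qed
      finally show ?thesis by (simp add: mult_left_mono mult.assoc)
    qed
    have "(\<Sum>n. ennreal (exp (a * real (Suc n) powr \<theta> - \<tau> * c * real (Suc n) powr \<rho>)))
        \<le> (\<Sum>n. ennreal (exp (D * T) * (B / \<tau> ^ m) * (1 / real (Suc n) ^ 2)))"
      by (intro suminf_le ennreal_leI summand) auto
    also have "\<dots> = ennreal (exp (D * T) * (B / \<tau> ^ m) * Z)"
    proof -
      have K: "0 \<le> exp (D * T) * (B / \<tau> ^ m)" using B \<tau> by simp
      then show ?thesis
        unfolding Z_def suminf_mult[OF sumZ, symmetric]
        by (intro suminf_ennreal2 mult_nonneg_nonneg[OF K] summable_mult sumZ) auto
    qed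
    also have "\<dots> \<le> ennreal (exp ((D + real m / \<gamma> + B * Z + 1) * T))"
    proof (rule ennreal_leI)
      \<comment> \<open>A power of 1 / \<tau> is harmless, since ln (1 / \<tau>) = ln T / \<gamma>
        and ln T \<le> T.\<close>
      have "1 / \<tau> ^ m \<le> exp (real m / \<gamma> * T)"
      proof -
        have "\<gamma> * ln (1 / \<tau>) = ln T" using \<tau> by (simp add: T_def ln_powr ln_div)
        also have "\<dots> \<le> T" using ln_le_minus_one[of T] T1 by linarith
        finally have "real m * ln (1 / \<tau>) \<le> real m / \<gamma> * T"
          using mult_left_mono[of _ T "real m / \<gamma>"] \<gamma> by fastforce
        moreover have "1 / \<tau> ^ m = exp (real m * ln (1 / \<tau>))"
          using \<tau> by (simp add: exp_of_nat_mult power_one_over)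
        ultimately show ?thesis by simp
      qed
      moreover have "B * Z \<le> exp (B * Z * T)"
      proof -
        have "B * Z \<le> B * Z * T" using mult_left_mono[OF T1, of "B * Z"] B Z by simp
        also have "\<dots> \<le> exp (B * Z * T)" using exp_ge_add_one_self[of "B * Z * T"] by linarith
        finally show ?thesis .
      qed
      ultimately have "exp (D * T) * (1 / \<tau> ^ m) * (B * Z)
          \<le> exp (D * T) * exp (real m / \<gamma> * T) * exp (B * Z * T)"
        using B Z \<tau> by (intro mult_mono) auto
      also have "\<dots> = exp ((D + real m / \<gamma> + B * Z) * T)"
        by (simp add: algebra_simps flip: exp_add)
      also have "\<dots> \<le> exp ((D + real m / \<gamma> + B * Z + 1) * T)"
        using T1 by (simp add: algebra_simps)
      finally show "exp (D * T) * (B / \<tau> ^ m) * Z \<le> exp ((D + real m / \<gamma> + B * Z + 1) * T)" by simp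
    qed
    finally show "(\<Sum>n. ennreal (exp (a * real (Suc n) powr \<theta> - \<tau> * c * real (Suc n) powr \<rho>)))
        \<le> ennreal (exp ((D + real m / \<gamma> + B * Z + 1) * \<tau> powr (- (\<theta> / (\<rho> - \<theta>)))))"
      unfolding T_def \<gamma>_def .
  qed
qed

text \<open>For \<open>s < 1\<close> the term whose factor \<open>real (Suc n)\<close> is \<open>s powr (- \<kappa> - 1)\<close> rounded up
  already suffices: there \<open>real (Suc n) * s\<close> is of the order of \<open>s powr (- \<kappa>)\<close>.\<close>

lemma exp_inverse_powr_le_exp_sum:
  fixes c \<kappa> s :: real
  assumes "0 \<le> c" "0 < \<kappa>" "0 < s"
  shows "ennreal (exp (c * s powr (- \<kappa>))) \<le> ennreal (exp c) +
    (\<Sum>n. ennreal (exp (1 + (c + 1) * real (Suc n) powr (\<kappa> / (1 + \<kappa>)))) * ennreal (exp (- real (Suc n) * s)))"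
proof (cases "1 \<le> s")
  case True
  then have "s powr (- \<kappa>) \<le> 1" using powr_mono[of "-\<kappa>" 0 s] assms by simp
  then have "exp (c * s powr (- \<kappa>)) \<le> exp c" using assms by (simp add: mult_left_le)
  then show ?thesis by (intro add_increasing2 ennreal_leI) auto
next
  case False
  define v where "v = s powr (- \<kappa> - 1)"
  \<comment> \<open>As v is positive, its ceiling is at least 1; subtracting 1 makes
    \<open>Suc k\<close> equal to that ceiling.\<close>
  define k where "k = nat \<lceil>v\<rceil> - 1"
  have v: "0 < v" using assms by (simp add: v_def)
  then have k: "v \<le> real (Suc k)" "real (Suc k) \<le> v + 1" unfolding k_def by linarith+
  have "v * s = s powr (- \<kappa>)"
    using assms powr_add[of s "-\<kappa> - 1" 1] by (simp add: v_def)
  moreover have "real (Suc k) * s \<le> (v + 1) * s" using k assms by (intro mult_right_mono) auto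
  ultimately have ns: "real (Suc k) * s \<le> s powr (- \<kappa>) + 1"
    using False by (simp add: distrib_right)
  have "s powr (- \<kappa>) = v powr (\<kappa> / (1 + \<kappa>))"
  proof -
    have "(- \<kappa> - 1) * (\<kappa> / (1 + \<kappa>)) = - \<kappa>" using assms by (simp add: field_simps)
    then show ?thesis by (simp add: v_def powr_powr)
  qed
  also have "\<dots> \<le> real (Suc k) powr (\<kappa> / (1 + \<kappa>))" using k v assms by (intro powr_mono2) auto
  finally have "(c + 1) * s powr (- \<kappa>) \<le> (c + 1) * real (Suc k) powr (\<kappa> / (1 + \<kappa>))"
    using assms by (intro mult_left_mono) auto
  \<comment> \<open>The extra 1 in c + 1 and the constant 1 pay for \<open>real (Suc k) * s\<close>,
    which is at most s powr (- \<kappa>) + 1.\<close>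
  then have "c * s powr (- \<kappa>) \<le> (1 + (c + 1) * real (Suc k) powr (\<kappa> / (1 + \<kappa>))) + - real (Suc k) * s"
    using ns by (simp add: distrib_right del: of_nat_Suc)
  then have "ennreal (exp (c * s powr (- \<kappa>))) \<le>
      ennreal (exp (1 + (c + 1) * real (Suc k) powr (\<kappa> / (1 + \<kappa>)))) * ennreal (exp (- real (Suc k) * s))"
    by (simp del: of_nat_Suc flip: ennreal_mult exp_add)
  also have "\<dots> \<le> (\<Sum>n. ennreal (exp (1 + (c + 1) * real (Suc n) powr (\<kappa> / (1 + \<kappa>)))) * ennreal (exp (- real (Suc n) * s)))"
    using sum_le_suminf[of "\<lambda>n. ennreal (exp (1 + (c + 1) * real (Suc n) powr (\<kappa> / (1 + \<kappa>)))) * ennreal (exp (- real (Suc n) * s))" "{k}"]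
    by (simp del: of_nat_Suc)
  finally show ?thesis by (rule order_trans) simp
qed

text \<open>The lower limit handles all large integers; the finitely many others are handled by
  positivity of \<phi> and a minimum.\<close>

lemma bernstein_lower_bound:
  fixes \<phi> :: "real \<Rightarrow> real"
  assumes "0 < Liminf at_top (\<lambda>u. ereal (\<phi> u * u powr (- \<rho>)))" and "\<And>u. 0 < u \<Longrightarrow> 0 < \<phi> u"
  obtains c where "0 < c" "\<And>n. c * real (Suc n) powr \<rho> \<le> \<phi> (real (Suc n))"
proof -
  obtain y where y: "0 < y" "y < Liminf at_top (\<lambda>u. ereal (\<phi> u * u powr (- \<rho>)))"
    using assms(1) dense by blast
  then obtain d where d: "y = ereal d" by (cases y) auto
  have "\<forall>\<^sub>F u in at_top. d < \<phi> u * u powr (- \<rho>)"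
    using less_LiminfD[OF y(2)] d by simp
  then obtain U where U: "\<And>u. U \<le> u \<Longrightarrow> d < \<phi> u * u powr (- \<rho>)"
    by (auto simp: eventually_at_top_linorder)
  define q where "q n = \<phi> (real (Suc n)) * real (Suc n) powr (- \<rho>)" for n
  define c where "c = Min (insert d (q ` {..nat \<lceil>U\<rceil>}))"
  have "0 < c" using y d assms(2) by (auto simp: c_def q_def)
  moreover have "c * real (Suc n) powr \<rho> \<le> \<phi> (real (Suc n))" for n
  proof -
    have "c \<le> q n"
    proof (cases "n \<le> nat \<lceil>U\<rceil>")
      case True
      then show ?thesis unfolding c_def by (intro Min_le) auto
    next
      case False
      then have "U \<le> real (Suc n)" by linarith
      then have "d \<le> q n" using U unfolding q_def by (intro less_imp_le)
      moreover have "c \<le> d" unfolding c_def by (intro Min_le) auto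
      ultimately show ?thesis by simp
    qed
    then have "c * real (Suc n) powr \<rho> \<le> q n * real (Suc n) powr \<rho>" by (intro mult_right_mono) auto
    also have "\<dots> = \<phi> (real (Suc n))"
      by (simp add: q_def powr_minus del: of_nat_Suc)
    finally show ?thesis .
  qed
  ultimately show ?thesis by (rule that)
qed

subsection \<open>Moments from the Laplace transform\<close>

locale laplace_family =
  fixes \<mu> :: "real \<Rightarrow> real measure" and \<phi> :: "real \<Rightarrow> real" and b :: real and \<nu> :: "real measure"
  assumes bernstein: "bernstein_function \<phi> b \<nu>"
    and prob: "0 \<le> t \<Longrightarrow> prob_space (\<mu> t)"
    and sets_eq [measurable_cong]: "0 \<le> t \<Longrightarrow> sets (\<mu> t) = sets borel"
    and nonneg: "0 \<le> t \<Longrightarrow> AE s in \<mu> t. 0 \<le> s"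
    and laplace: "0 \<le> t \<Longrightarrow> 0 < u \<Longrightarrow> (\<integral>s. exp (- u * s) \<partial>\<mu> t) = exp (- t * \<phi> u)"
begin

lemma phi_pos: "0 < u \<Longrightarrow> 0 < \<phi> u"
  using bernstein unfolding bernstein_function_def by blast

lemma integrable_bounded:
  assumes "0 \<le> t" "f \<in> borel_measurable borel" "\<And>s. 0 \<le> s \<Longrightarrow> \<bar>f s\<bar> \<le> B"
  shows "integrable (\<mu> t) (f :: real \<Rightarrow> real)"
proof -
  interpret prob_space "\<mu> t" using prob assms by simp
  have "f \<in> borel_measurable (\<mu> t)" using assms(2) sets_eq[OF assms(1)] by (simp cong: measurable_cong_sets)
  then show ?thesis
    using nonneg[OF assms(1)] assms(3) by (intro integrable_const_bound[of _ B]) (auto elim: eventually_mono)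
qed

lemma nn_laplace:
  assumes "0 \<le> t" "0 < u"
  shows "(\<integral>\<^sup>+s. ennreal (exp (- u * s)) \<partial>\<mu> t) = ennreal (exp (- t * \<phi> u))"
  using assms laplace[OF assms]
  by (subst nn_integral_eq_integral) (auto intro!: integrable_bounded[where B = 1])

section \<open>Moments of negative powers\<close>

text \<open>An atom at 0 would have mass at most exp (- t \<phi> (n + 1)) for every n, and this
  tends to 0. Excluding it matters because the Harnack inequality of the original semigroup is
  available at strictly positive times.\<close>

lemma AE_positive:
  assumes "0 < t" "0 < c" "0 < \<rho>" and lower: "\<And>n. c * real (Suc n) powr \<rho> \<le> \<phi> (real (Suc n))"
  shows "AE s in \<mu> t. 0 < s"
proof -
  have t: "0 \<le> t" using assms by simp
  have m [measurable]: "{0} \<in> sets (\<mu> t)" using sets_eq[OF t] by simp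
  have "emeasure (\<mu> t) {0} \<le> ennreal (exp (- (t * c) * real (Suc n) powr \<rho>))" for n
  proof -
    have "emeasure (\<mu> t) {0} = (\<integral>\<^sup>+s. indicator {0} s \<partial>\<mu> t)"
      by simp
    also have "\<dots> \<le> (\<integral>\<^sup>+s. ennreal (exp (- real (Suc n) * s)) \<partial>\<mu> t)"
      by (intro nn_integral_mono) (auto split: split_indicator)
    also have "\<dots> = ennreal (exp (- t * \<phi> (real (Suc n))))"
      by (intro nn_laplace t) simp
    also have "\<dots> \<le> ennreal (exp (- (t * c) * real (Suc n) powr \<rho>))"
      using mult_left_mono[OF lower t] by (intro ennreal_leI) (simp add: mult.assoc)
    finally show ?thesis .
  qed
  moreover have "(\<lambda>n. ennreal (exp (- (t * c) * real (Suc n) powr \<rho>))) \<longlonglongrightarrow> ennreal 0"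
  proof (rule tendsto_ennrealI)
    have "filterlim (\<lambda>n. real (Suc n) powr \<rho>) at_top sequentially"
      using \<open>0 < \<rho>\<close> by (intro filterlim_compose[OF real_powr_at_top filterlim_compose[OF filterlim_real_sequentially filterlim_Suc]])
    then have "filterlim (\<lambda>n. - (t * c) * real (Suc n) powr \<rho>) at_bot sequentially"
      using assms by (intro filterlim_tendsto_neg_mult_at_bot[OF tendsto_const]) auto
    then show "(\<lambda>n. exp (- (t * c) * real (Suc n) powr \<rho>)) \<longlonglongrightarrow> 0"
      by (rule filterlim_compose[OF exp_at_bot])
  qed
  ultimately have "emeasure (\<mu> t) {0} \<le> ennreal 0"
    by (intro tendsto_lowerbound) auto
  then have "{0} \<in> null_sets (\<mu> t)" using m by auto
  then have "AE s in \<mu> t. s \<notin> {0}" by (rule AE_not_in)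
  with nonneg[OF t] show ?thesis by eventually_elim auto
qed

text \<open>The series that dominates exp (c s powr (- \<kappa>)) is integrated term by term. The
  Laplace transform supplies the decay exp (- t \<phi> (n + 1)), and
  \<open>exp_minus_rate_sum_bound\<close> sums the result.\<close>

lemma inverse_moment_bound:
  assumes "0 \<le> c" "0 < \<kappa>" "\<kappa> / (1 + \<kappa>) < \<rho>"
    and "0 < Liminf at_top (\<lambda>u. ereal (\<phi> u * u powr (- \<rho>)))"
  obtains C where "0 < C"
    and "\<And>t. 0 < t \<Longrightarrow> (\<integral>\<^sup>+s. ennreal (exp (c * s powr (- \<kappa>))) \<partial>\<mu> t)
        \<le> ennreal (exp (C / min t 1 powr (\<kappa> / (\<rho> - (1 - \<rho>) * \<kappa>))))"
proof -
  define \<theta> where "\<theta> = \<kappa> / (1 + \<kappa>)"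
  have \<theta>: "0 < \<theta>" "\<theta> < \<rho>" using assms by (auto simp: \<theta>_def)
  \<comment> \<open>Identifies the exponent of the series bound with the one required in the
    theorem.\<close>
  have \<gamma>: "\<theta> / (\<rho> - \<theta>) = \<kappa> / (\<rho> - (1 - \<rho>) * \<kappa>)"
  proof -
    have "\<rho> - \<theta> = (\<rho> - (1 - \<rho>) * \<kappa>) / (1 + \<kappa>)" using assms by (simp add: \<theta>_def field_simps)
    then show ?thesis using assms by (simp add: \<theta>_def)
  qed
  obtain d where d: "0 < d" "\<And>n. d * real (Suc n) powr \<rho> \<le> \<phi> (real (Suc n))"
    using bernstein_lower_bound[OF assms(4) phi_pos] by blast
  obtain C where C: "0 < C" "\<And>\<tau>. 0 < \<tau> \<Longrightarrow> \<tau> \<le> 1 \<Longrightarrow>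
      (\<Sum>n. ennreal (exp ((c + 1) * real (Suc n) powr \<theta> - \<tau> * d * real (Suc n) powr \<rho>)))
        \<le> ennreal (exp (C * \<tau> powr (- (\<theta> / (\<rho> - \<theta>)))))"
    using exp_minus_rate_sum_bound[OF add_nonneg_nonneg[OF assms(1) zero_le_one] d(1) \<theta>] by blast
  show ?thesis
  proof (rule that[of "C + c + 2"])
    show "0 < C + c + 2" using C assms by simp
    fix t :: real assume t: "0 < t"
    interpret prob_space "\<mu> t" using prob t by simp
    have t0 [simp]: "0 \<le> t" using t by simp
    note [measurable_cong] = sets_eq[OF t0]
    \<comment> \<open>The series bound covers rates up to 1; replacing t by the smaller \<tau> only
      weakens the decay.\<close>
    define \<tau> where "\<tau> = min t 1"
    define T where "T = \<tau> powr (- (\<theta> / (\<rho> - \<theta>)))"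
    have \<tau>: "0 < \<tau>" "\<tau> \<le> 1" "\<tau> \<le> t" using t by (auto simp: \<tau>_def)
    have T1: "1 \<le> T"
      using powr_mono'[of "- (\<theta> / (\<rho> - \<theta>))" 0 \<tau>] \<tau> \<theta> by (simp add: T_def)
    have "(\<integral>\<^sup>+s. ennreal (exp (c * s powr (- \<kappa>))) \<partial>\<mu> t) \<le> (\<integral>\<^sup>+s. ennreal (exp c) +
        (\<Sum>n. ennreal (exp (1 + (c + 1) * real (Suc n) powr \<theta>)) * ennreal (exp (- real (Suc n) * s))) \<partial>\<mu> t)"
      unfolding \<theta>_def
      by (intro nn_integral_mono_AE eventually_mono[OF AE_positive[OF t d(1) less_trans[OF \<theta>] d(2)]]
          exp_inverse_powr_le_exp_sum assms)
    also have "\<dots> = ennreal (exp c) +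
        (\<Sum>n. ennreal (exp (1 + (c + 1) * real (Suc n) powr \<theta>)) * (\<integral>\<^sup>+s. ennreal (exp (- real (Suc n) * s)) \<partial>\<mu> t))"
      by (simp add: nn_integral_add nn_integral_suminf nn_integral_cmult emeasure_space_1 del: of_nat_Suc)
    also have "(\<Sum>n. ennreal (exp (1 + (c + 1) * real (Suc n) powr \<theta>)) * (\<integral>\<^sup>+s. ennreal (exp (- real (Suc n) * s)) \<partial>\<mu> t))
       \<le> (\<Sum>n. ennreal (exp 1) * ennreal (exp ((c + 1) * real (Suc n) powr \<theta> - \<tau> * d * real (Suc n) powr \<rho>)))"
    proof (intro suminf_le)
      fix n
      have "\<tau> * (d * real (Suc n) powr \<rho>) \<le> t * \<phi> (real (Suc n))"
        using \<tau> d by (intro mult_mono) auto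
      then show "ennreal (exp (1 + (c + 1) * real (Suc n) powr \<theta>)) * (\<integral>\<^sup>+s. ennreal (exp (- real (Suc n) * s)) \<partial>\<mu> t)
          \<le> ennreal (exp 1) * ennreal (exp ((c + 1) * real (Suc n) powr \<theta> - \<tau> * d * real (Suc n) powr \<rho>))"
        by (subst nn_laplace) (auto simp del: of_nat_Suc simp: mult.assoc simp flip: ennreal_mult exp_add)
    qed auto
    also have "\<dots> = ennreal (exp 1) * (\<Sum>n. ennreal (exp ((c + 1) * real (Suc n) powr \<theta> - \<tau> * d * real (Suc n) powr \<rho>)))"
      by simp
    also have "\<dots> \<le> ennreal (exp 1) * ennreal (exp (C * T))"
      unfolding T_def by (intro mult_left_mono C \<tau>) auto
    also have "ennreal (exp c) + ennreal (exp 1) * ennreal (exp (C * T)) = ennreal (exp c + exp (1 + C * T))"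
      by (simp add: exp_add flip: ennreal_mult ennreal_plus)
    \<comment> \<open>In C + c + 2, the c comes from the region s \<ge> 1, one unit from the factor
      exp 1, and one from 2 \<le> exp 1. Since T \<ge> 1, all of them may be multiplied by
      T.\<close>
    also have "exp c + exp (1 + C * T) \<le> exp ((C + c + 2) * T)"
    proof -
      have CT: "0 \<le> C * T" using C T1 by simp
      have "exp c + exp (1 + C * T) \<le> exp (1 + C * T + c) + exp (1 + C * T + c)"
        using CT assms by (intro add_mono) auto
      also have "\<dots> \<le> exp 1 * exp (1 + C * T + c)"
        using exp_ge_add_one_self[of 1] mult_right_mono[of 2 "exp 1" "exp (1 + C * T + c)"] by simp
      also have "\<dots> = exp (C * T + (c + 2))" by (simp flip: exp_add add: algebra_simps)
      also have "\<dots> \<le> exp (C * T + (c + 2) * T)"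
        using T1 assms by (simp add: mult_le_cancel_left1)
      finally show ?thesis by (simp add: algebra_simps)
    qed
    also have "(C + c + 2) * T = (C + c + 2) / min t 1 powr (\<kappa> / (\<rho> - (1 - \<rho>) * \<kappa>))"
      unfolding T_def \<gamma> by (simp add: powr_minus \<tau>_def divide_inverse)
    finally show "(\<integral>\<^sup>+s. ennreal (exp (c * s powr (- \<kappa>))) \<partial>\<mu> t)
        \<le> ennreal (exp ((C + c + 2) / min t 1 powr (\<kappa> / (\<rho> - (1 - \<rho>) * \<kappa>))))"
      by (auto simp: ennreal_leI)
  qed
qed

section \<open>Integrability with respect to the Levy measure\<close>

lemma levy_sets [measurable_cong, simp]: "sets \<nu> = sets borel"
  and drift_nonneg: "0 \<le> b"
  and phi_eq: "0 < u \<Longrightarrow> \<phi> u = b * u + (\<integral>y. 1 - exp (- u * y) \<partial>\<nu>)"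
  using bernstein unfolding bernstein_function_def by auto

lemma levy_AE_pos: "AE y in \<nu>. 0 < y"
proof -
  have "{..0} \<in> null_sets \<nu>"
    using bernstein unfolding bernstein_function_def by (auto simp: null_sets_def)
  then have "AE y in \<nu>. y \<notin> {..0}" by (rule AE_not_in)
  then show ?thesis by eventually_elim auto
qed

lemma levy_integrable_min: "integrable \<nu> (\<lambda>y. min y 1)"
proof (rule integrableI_nonneg)
  show "AE y in \<nu>. 0 \<le> min y 1" using levy_AE_pos by eventually_elim auto
  show "(\<integral>\<^sup>+y. ennreal (min y 1) \<partial>\<nu>) < \<infinity>"
    using bernstein unfolding bernstein_function_def by auto
qed measurable

lemma levy_integrable_le_min:
  assumes [measurable]: "f \<in> borel_measurable borel"
    and "\<And>y. 0 < y \<Longrightarrow> \<bar>f y\<bar> \<le> c * min y 1"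
  shows "integrable \<nu> (f :: real \<Rightarrow> real)"
proof (rule Bochner_Integration.integrable_bound)
  show "integrable \<nu> (\<lambda>y. c * min y 1)" using levy_integrable_min by simp
  show "AE y in \<nu>. norm (f y) \<le> norm (c * min y 1)"
    using levy_AE_pos
    by eventually_elim (simp only: real_norm_def, rule order_trans[OF assms(2) abs_ge_self], assumption)
qed simp

lemma levy_integrable_one_minus_exp: "0 \<le> u \<Longrightarrow> integrable \<nu> (\<lambda>y. 1 - exp (- u * y))"
  using one_minus_exp_le_min[of u] by (intro levy_integrable_le_min[where c = "max u 1"]) auto

text \<open>Since \<open>\<phi>\<close> is unspecified at \<open>0\<close>, constant terms of polynomials need the Levy-Khintchine formula itself.\<close>

definition \<psi> :: "real \<Rightarrow> real" where "\<psi> u = b * u + (\<integral>y. 1 - exp (- u * y) \<partial>\<nu>)"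

lemma laplace_closed:
  assumes "0 \<le> t" "0 \<le> u"
  shows "(\<integral>s. exp (- u * s) \<partial>\<mu> t) = exp (- t * \<psi> u)"
proof (cases "u = 0")
  case True
  interpret prob_space "\<mu> t" using prob assms by simp
  show ?thesis using True by (simp add: \<psi>_def prob_space)
next
  case False
  then show ?thesis using laplace[of t u] phi_eq[of u] assms by (simp add: \<psi>_def)
qed

section \<open>Polynomials in a decaying exponential and the generator\<close>

text \<open>Powers of exp (- s / N) are again exponentials in s, so the expectation is read off from
  the Laplace transform at the points i / N, including i = 0.\<close>

lemma integral_exp_polynomial:
  assumes "0 \<le> t" "0 < N"
  shows "integrable (\<mu> t) (\<lambda>s. \<Sum>i\<le>n. a i * exp (- s / N) ^ i)"
    and "(\<integral>s. (\<Sum>i\<le>n. a i * exp (- s / N) ^ i) \<partial>\<mu> t) = (\<Sum>i\<le>n. a i * exp (- t * \<psi> (real i / N)))"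
proof -
  have pow: "exp (- s / N) ^ i = exp (- (real i / N) * s)" for s i
    by (simp flip: exp_of_nat_mult)
  have int: "integrable (\<mu> t) (\<lambda>s. exp (- (real i / N) * s))" for i
    using assms by (intro integrable_bounded[where B = 1]) auto
  show "integrable (\<mu> t) (\<lambda>s. \<Sum>i\<le>n. a i * exp (- s / N) ^ i)"
    unfolding pow by (intro Bochner_Integration.integrable_sum integrable_mult_right int)
  show "(\<integral>s. (\<Sum>i\<le>n. a i * exp (- s / N) ^ i) \<partial>\<mu> t) = (\<Sum>i\<le>n. a i * exp (- t * \<psi> (real i / N)))"
    unfolding pow using assms
    by (simp only: Bochner_Integration.integral_sum integrable_mult_right int integral_mult_right_zero)
       (simp add: laplace_closed[of t "real _ / N", simplified])
qed

text \<open>The generator \<open>F \<mapsto> b F' + \<integral>(F(\<cdot> + y) - F) d\<nu>\<close> on polynomials in \<open>x = exp (- s / N)\<close>.\<close>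

lemma generator_polynomial:
  assumes "0 < N"
  shows "integrable \<nu> (\<lambda>y. (\<Sum>i\<le>n. a i * (x * exp (- y / N)) ^ i) - (\<Sum>i\<le>n. a i * x ^ i))"
    and "(\<Sum>i\<le>n. - a i * \<psi> (real i / N) * x ^ i) = - (b / N) * (\<Sum>i\<le>n. a i * real i * x ^ i) +
      (\<integral>y. (\<Sum>i\<le>n. a i * (x * exp (- y / N)) ^ i) - (\<Sum>i\<le>n. a i * x ^ i) \<partial>\<nu>)"
proof -
  \<comment> \<open>Taking the difference produces factors 1 - exp (- (i / N) y), which \<nu>
    integrates even if its mass is infinite.\<close>
  have eq: "(\<Sum>i\<le>n. a i * (x * exp (- y / N)) ^ i) - (\<Sum>i\<le>n. a i * x ^ i) =
      (\<Sum>i\<le>n. - (a i * x ^ i) * (1 - exp (- (real i / N) * y)))" for y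
    by (simp add: power_mult_distrib algebra_simps sum_subtractf flip: exp_of_nat_mult)
  have int: "integrable \<nu> (\<lambda>y. 1 - exp (- (real i / N) * y))" for i
    using assms by (intro levy_integrable_one_minus_exp) simp
  show "integrable \<nu> (\<lambda>y. (\<Sum>i\<le>n. a i * (x * exp (- y / N)) ^ i) - (\<Sum>i\<le>n. a i * x ^ i))"
    unfolding eq by (intro Bochner_Integration.integrable_sum integrable_mult_right int)
  have "(\<integral>y. (\<Sum>i\<le>n. a i * (x * exp (- y / N)) ^ i) - (\<Sum>i\<le>n. a i * x ^ i) \<partial>\<nu>) =
      (\<Sum>i\<le>n. - (a i * x ^ i) * (\<integral>y. 1 - exp (- (real i / N) * y) \<partial>\<nu>))"
    unfolding eq by (simp only: Bochner_Integration.integral_sum integrable_mult_right int integral_mult_right_zero)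
  moreover have "(\<Sum>i\<le>n. - a i * \<psi> (real i / N) * x ^ i) =
      (\<Sum>i\<le>n. - (b / N) * (a i * real i * x ^ i) + - (a i * x ^ i) * (\<integral>y. 1 - exp (- (real i / N) * y) \<partial>\<nu>))"
    by (intro sum.cong) (auto simp: \<psi>_def algebra_simps)
  ultimately show "(\<Sum>i\<le>n. - a i * \<psi> (real i / N) * x ^ i) = - (b / N) * (\<Sum>i\<le>n. a i * real i * x ^ i) +
      (\<integral>y. (\<Sum>i\<le>n. a i * (x * exp (- y / N)) ^ i) - (\<Sum>i\<le>n. a i * x ^ i) \<partial>\<nu>)"
    by (simp only: sum.distrib sum_distrib_left)
qed

text \<open>The expectation \<open>m\<close> is a finite sum of exponentials in time, and its
  derivative is the expectation of the generator applied to the polynomial. The hypothesis thus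
  gives m' \<le> C m, so m(t) exp (- C t) is nonincreasing.\<close>

lemma gronwall_polynomial:
  assumes "0 < N" "0 \<le> t"
    and "\<And>x. x \<in> {0..1} \<Longrightarrow> (\<Sum>i\<le>n. - a i * \<psi> (real i / N) * x ^ i) \<le> C * (\<Sum>i\<le>n. a i * x ^ i)"
  shows "(\<integral>s. (\<Sum>i\<le>n. a i * exp (- s / N) ^ i) \<partial>\<mu> t) \<le> exp (C * t) * (\<Sum>i\<le>n. a i)"
proof -
  define m where "m \<tau> = (\<Sum>i\<le>n. a i * exp (- \<tau> * \<psi> (real i / N)))" for \<tau>
  define m' where "m' \<tau> = (\<Sum>i\<le>n. - a i * \<psi> (real i / N) * exp (- \<tau> * \<psi> (real i / N)))" for \<tau>
  have deriv: "(m has_real_derivative m' \<tau>) (at \<tau>)" for \<tau>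
    unfolding m_def m'_def by (auto intro!: derivative_eq_intros sum.cong)
  have m'_le: "m' \<tau> \<le> C * m \<tau>" if "0 \<le> \<tau>" for \<tau>
  proof -
    \<comment> \<open>The derivative is itself the expectation of a polynomial in exp (- s / N), so
      the pointwise hypothesis can be integrated.\<close>
    have "m' \<tau> = (\<integral>s. (\<Sum>i\<le>n. - a i * \<psi> (real i / N) * exp (- s / N) ^ i) \<partial>\<mu> \<tau>)"
      unfolding m'_def by (rule integral_exp_polynomial(2)[OF that assms(1), symmetric])
    also have "\<dots> \<le> (\<integral>s. C * (\<Sum>i\<le>n. a i * exp (- s / N) ^ i) \<partial>\<mu> \<tau>)"
      using nonneg[OF that] assms
      by (intro integral_mono_AE integral_exp_polynomial[OF that] integrable_mult_right)
         (auto elim!: eventually_mono)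
    also have "\<dots> = C * m \<tau>"
      unfolding m_def using integral_exp_polynomial(2)[OF that assms(1)] by simp
    finally show ?thesis .
  qed
  have "m t * exp (- C * t) \<le> m 0 * exp (- C * 0)"
  proof (rule DERIV_nonpos_imp_nonincreasing[OF assms(2)])
    fix \<tau> assume \<tau>: "0 \<le> \<tau>" "\<tau> \<le> t"
    have "((\<lambda>\<tau>. m \<tau> * exp (- C * \<tau>)) has_real_derivative (m' \<tau> - C * m \<tau>) * exp (- C * \<tau>)) (at \<tau>)"
      by (auto intro!: derivative_eq_intros deriv simp: algebra_simps)
    then show "\<exists>y. ((\<lambda>\<tau>. m \<tau> * exp (- C * \<tau>)) has_real_derivative y) (at \<tau>) \<and> y \<le> 0"
      using m'_le[OF \<tau>(1)] by (intro exI conjI) (auto intro!: mult_nonpos_nonneg)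
  qed
  then have "m t * exp (- C * t) * exp (C * t) \<le> m 0 * exp (C * t)"
    by (intro mult_right_mono) auto
  also have "m t * exp (- C * t) * exp (C * t) = m t" by (simp add: mult.assoc flip: exp_add)
  finally show ?thesis
    using integral_exp_polynomial(2)[OF assms(2,1), of a n] by (simp add: m_def mult.commute)
qed

section \<open>Exponential moments of positive powers\<close>

text \<open>For F = exp g with g subadditive, F(s + y) - F(s) \<le> F(s) (F(y) - 1), while the slope
  bound on g gives F' \<le> \<beta> F. So the generator maps F below a multiple of F as soon as
  \<nu> integrates F - 1.\<close>

lemma exponential_moment_bound:
  assumes lam: "0 \<le> \<beta>" and \<kappa>: "0 \<le> \<kappa>" "\<kappa> \<le> 1"
    and fin: "(\<integral>\<^sup>+y\<in>{1..}. ennreal (exp (\<beta> * y powr \<kappa>)) \<partial>\<nu>) < \<infinity>"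
  obtains C where "0 < C"
    and "\<And>t. 0 \<le> t \<Longrightarrow> (\<integral>\<^sup>+s. ennreal (exp (\<beta> * s powr \<kappa>)) \<partial>\<mu> t) \<le> ennreal (exp (C * max t 1))"
proof -
  \<comment> \<open>Shifting the argument by \<open>1\<close> keeps subadditivity and makes \<open>g\<close> Lipschitz at \<open>0\<close>,
    near which \<open>\<nu>\<close> integrates \<open>y\<close> but not necessarily \<open>y powr \<kappa>\<close>.\<close>
  define g where "g y = \<beta> * ((1 + y) powr \<kappa> - 1)" for y
  have [measurable]: "g \<in> borel_measurable borel" unfolding g_def by measurable
  have g_nonneg: "0 \<le> g y" if "0 \<le> y" for y
    using that lam \<kappa> by (simp add: g_def ge_one_powr_ge_zero)
  have g_mono: "g x \<le> g y" if "0 \<le> x" "x \<le> y" for x y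
    using that lam \<kappa> unfolding g_def by (intro mult_left_mono diff_right_mono powr_mono2) auto
  have g_subadd: "g (x + y) \<le> g x + g y" if "0 \<le> x" "0 \<le> y" for x y
    using mult_left_mono[OF powr_shift_subadditive[OF \<kappa> that] lam] by (simp add: g_def algebra_simps)
  have g_linear: "g y \<le> \<beta> * y" if "0 \<le> y" for y
    using powr_mono[of \<kappa> 1 "1 + y"] that lam \<kappa> unfolding g_def by (intro mult_left_mono) auto
  have g_le: "g y \<le> \<beta> * y powr \<kappa>" and g_ge: "\<beta> * y powr \<kappa> \<le> \<beta> + g y" if "0 \<le> y" for y
  proof -
    show "g y \<le> \<beta> * y powr \<kappa>"
      using powr_one_plus_le[OF \<kappa> that] lam unfolding g_def by (intro mult_left_mono) auto
    have "\<beta> * y powr \<kappa> \<le> \<beta> * (1 + y) powr \<kappa>"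
      using that lam \<kappa> by (intro mult_left_mono powr_mono2) auto
    then show "\<beta> * y powr \<kappa> \<le> \<beta> + g y" by (simp add: g_def algebra_simps)
  qed

  have exp_g_integrable: "integrable \<nu> (\<lambda>y. exp (g y) - 1)"
  proof (rule integrableI_nonneg)
    show "AE y in \<nu>. 0 \<le> exp (g y) - 1"
      using levy_AE_pos by eventually_elim (simp add: g_nonneg)
    \<comment> \<open>Below 1 the linear bound on \<open>g\<close> gives a multiple of y; above 1
      the comparison with \<beta> y powr \<kappa> brings in the hypothesis on \<nu>.\<close>
    have bound: "ennreal (exp (g y) - 1) \<le> ennreal (\<beta> * exp \<beta> * min y 1) +
        ennreal (exp (\<beta> * y powr \<kappa>)) * indicator {1..} y" if "0 < y" for y
    proof (cases "1 \<le> y")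
      case True
      have "exp (g y) - 1 \<le> exp (\<beta> * y powr \<kappa>)"
        using g_le[of y] True by (smt (verit) exp_le_cancel_iff)
      then show ?thesis using True by (intro add_increasing) (auto intro: ennreal_leI)
    next
      case False
      have "exp (g y) - 1 \<le> exp (\<beta> * y) - 1" using g_linear[of y] that by simp
      also have "\<dots> \<le> \<beta> * y * exp (\<beta> * y)" by (rule exp_minus_one_le)
      also have "\<dots> \<le> \<beta> * y * exp \<beta>" using False that lam by (intro mult_left_mono) (auto simp: mult_left_le)
      finally show ?thesis using False by (intro add_increasing2 ennreal_leI) (auto simp: mult.commute mult.left_commute)
    qed
    have "(\<integral>\<^sup>+y. ennreal (exp (g y) - 1) \<partial>\<nu>) \<le> (\<integral>\<^sup>+y. ennreal (\<beta> * exp \<beta> * min y 1) +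
        ennreal (exp (\<beta> * y powr \<kappa>)) * indicator {1..} y \<partial>\<nu>)"
      using levy_AE_pos by (intro nn_integral_mono_AE) (auto elim!: eventually_mono intro: bound)
    also have "\<dots> = (\<integral>\<^sup>+y. ennreal (\<beta> * exp \<beta> * min y 1) \<partial>\<nu>) +
        (\<integral>\<^sup>+y\<in>{1..}. ennreal (exp (\<beta> * y powr \<kappa>)) \<partial>\<nu>)"
      by (intro nn_integral_add) measurable
    also have "\<dots> < \<infinity>"
    proof -
      have "integrable \<nu> (\<lambda>y. \<beta> * exp \<beta> * min y 1)" using levy_integrable_min by simp
      then have "(\<integral>\<^sup>+y. ennreal (\<beta> * exp \<beta> * min y 1) \<partial>\<nu>) < \<infinity>"
        using real_integrable_def[of \<nu> "\<lambda>y. \<beta> * exp \<beta> * min y 1"] by (simp add: top.not_eq_extremum)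
      then show ?thesis using fin by simp
    qed
    finally show "(\<integral>\<^sup>+y. ennreal (exp (g y) - 1) \<partial>\<nu>) < \<infinity>" .
  qed measurable

  \<comment> \<open>The summand \<open>min y 1\<close> makes room for the approximation error in the
    jump part.\<close>
  define K where "K = (\<integral>y. (exp (g y) - 1) + min y 1 \<partial>\<nu>)"
  have K_int: "integrable \<nu> (\<lambda>y. (exp (g y) - 1) + min y 1)"
    using exp_g_integrable levy_integrable_min by (rule Bochner_Integration.integrable_add)
  have K: "0 \<le> K"
    unfolding K_def by (intro integral_nonneg_AE eventually_mono[OF levy_AE_pos]) (simp add: g_nonneg)
  \<comment> \<open>The bracket bounds the generator relative to \<open>Q\<close>; the factor 2
    comes from passing from \<open>Q\<close> to its approximation \<open>p\<close>. Nothing here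
    depends on \<open>N\<close>, which the later limit requires.\<close>
  define C where "C = 2 * (b * \<beta> + b + K)"
  have C: "0 \<le> C" using K lam drift_nonneg by (simp add: C_def)

  have approx: "(\<integral>\<^sup>+s. ennreal (exp (g (N * (1 - exp (- s / N))))) \<partial>\<mu> t) \<le> ennreal (2 * exp (C * t))"
    if N: "1 \<le> N" and t: "0 \<le> t" for N t
  proof -
    \<comment> \<open>With x = exp (- s / N) the argument N (1 - x) stays in [0, N], so
      \<open>Q\<close> is continuously differentiable on the closed unit interval.\<close>
    define Q where "Q x = exp (g (N * (1 - x)))" for x
    define Q' where "Q' x = Q x * (\<beta> * (\<kappa> * (1 + N * (1 - x)) powr (\<kappa> - 1) * - N))" for x
    have pos: "0 < 1 + N * (1 - x)" if "x \<in> {0..1}" for x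
      using that N by (intro add_pos_nonneg) auto
    have Q_deriv: "(Q has_real_derivative Q' x) (at x within {0..1})" if "x \<in> {0..1}" for x
      unfolding Q_def g_def Q'_def using pos[OF that] by (auto intro!: derivative_eq_intros)
    have Q'_cont: "continuous_on {0..1} Q'"
      unfolding Q'_def Q_def g_def using pos by (intro continuous_intros) force+
    obtain a n where a1: "(\<Sum>i\<le>n. a i) = Q 1"
      and a2: "\<And>x y. 0 \<le> x \<Longrightarrow> x \<le> y \<Longrightarrow> y \<le> 1 \<Longrightarrow>
        \<bar>((\<Sum>i\<le>n. a i * y ^ i) - Q y) - ((\<Sum>i\<le>n. a i * x ^ i) - Q x)\<bar> \<le> 1 / 2 * (y - x)"
      and a3: "\<And>x. x \<in> {0..1} \<Longrightarrow> \<bar>(\<Sum>i\<le>n. a i * real i * x ^ i) - x * Q' x\<bar> \<le> 1 / 2"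
      using polynomial_approx_C1[OF Q_deriv Q'_cont, of "1 / 2"] by auto
    define p where "p x = (\<Sum>i\<le>n. a i * x ^ i)" for x
    have Q1: "1 \<le> Q x" if "x \<in> {0..1}" for x
      using that N g_nonneg[of "N * (1 - x)"] by (simp add: Q_def)
    have "Q 1 = 1" by (simp add: Q_def g_def)
    \<comment> \<open>The error vanishes at 1, hence is at most 1/2 everywhere, which is at most
      half of Q x.\<close>
    have Q_le_p: "Q x \<le> 2 * p x" if "x \<in> {0..1}" for x
    proof -
      have "\<bar>(p 1 - Q 1) - (p x - Q x)\<bar> \<le> 1 / 2 * (1 - x)"
        using a2[of x 1] that by (simp add: p_def)
      moreover have "p 1 = Q 1" by (simp add: p_def a1)
      ultimately have "\<bar>Q x - p x\<bar> \<le> 1 / 2" using that by simp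
      then show ?thesis using Q1[OF that] by linarith
    qed
    have gen: "(\<Sum>i\<le>n. - a i * \<psi> (real i / N) * x ^ i) \<le> C * p x" if x: "x \<in> {0..1}" for x
    proof -
      have "(\<Sum>i\<le>n. - a i * \<psi> (real i / N) * x ^ i) = - (b / N) * (\<Sum>i\<le>n. a i * real i * x ^ i) +
          (\<integral>y. p (x * exp (- y / N)) - p x \<partial>\<nu>)"
        unfolding p_def using N by (intro generator_polynomial) simp
      also have "\<dots> \<le> b * (\<beta> + 1) * Q x + K * Q x"
      proof (intro add_mono)
        \<comment> \<open>The power has base at least 1 and exponent \<kappa> - 1 \<le> 0. The
          factor N cancels against the drift coefficient b / N, and the 1 in \<beta> + 1 will absorb
          the approximation error.\<close>
        have "\<bar>x * Q' x\<bar> \<le> N * \<beta> * Q x"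
        proof -
          have "(1 + N * (1 - x)) powr (\<kappa> - 1) \<le> 1"
            using powr_mono[of "\<kappa> - 1" 0 "1 + N * (1 - x)"] N x \<kappa> by simp
          then have "x * (\<kappa> * (1 + N * (1 - x)) powr (\<kappa> - 1)) \<le> 1 * (1 * 1)"
            using x \<kappa> by (intro mult_mono) auto
          then have "(N * \<beta> * Q x) * (x * (\<kappa> * (1 + N * (1 - x)) powr (\<kappa> - 1))) \<le> (N * \<beta> * Q x) * 1"
            using N lam Q1[OF x] by (intro mult_left_mono) auto
          moreover have "\<bar>x * Q' x\<bar> = (N * \<beta> * Q x) * (x * (\<kappa> * (1 + N * (1 - x)) powr (\<kappa> - 1)))"
            using x N lam \<kappa> Q1[OF x] by (simp add: Q'_def abs_mult)
          ultimately show ?thesis by simp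
        qed
        then have "- (\<Sum>i\<le>n. a i * real i * x ^ i) \<le> N * \<beta> * Q x + 1 / 2"
          using a3[OF x] by linarith
        also have "\<dots> \<le> N * ((\<beta> + 1) * Q x)"
        proof -
          have "1 * 1 \<le> N * Q x" using N Q1[OF x] by (intro mult_mono) auto
          then show ?thesis by (simp add: algebra_simps)
        qed
        finally have "b / N * (- (\<Sum>i\<le>n. a i * real i * x ^ i)) \<le> b / N * (N * ((\<beta> + 1) * Q x))"
          using N drift_nonneg by (intro mult_left_mono) auto
        then show "- (b / N) * (\<Sum>i\<le>n. a i * real i * x ^ i) \<le> b * (\<beta> + 1) * Q x"
          using N by (simp add: mult.assoc)
        have "(\<integral>y. p (x * exp (- y / N)) - p x \<partial>\<nu>) \<le> (\<integral>y. Q x * ((exp (g y) - 1) + min y 1) \<partial>\<nu>)"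
        proof (intro integral_mono_AE eventually_mono[OF levy_AE_pos])
          show "integrable \<nu> (\<lambda>y. p (x * exp (- y / N)) - p x)"
            unfolding p_def using N by (intro generator_polynomial) simp
          show "integrable \<nu> (\<lambda>y. Q x * ((exp (g y) - 1) + min y 1))"
            using K_int by (rule integrable_mult_right)
          fix y :: real assume y: "0 < y"
          define z where "z = exp (- y / N)"
          have z: "0 \<le> z" "z \<le> 1" using y N by (auto simp: z_def)
          \<comment> \<open>A jump y therefore raises the argument N (1 - x) by at most y, uniformly
            in N.\<close>
          have Nz: "N * (1 - z) \<le> y"
            using exp_ge_add_one_self[of "- y / N"] N by (simp add: z_def field_simps)
          have "1 * (1 - z) \<le> N * (1 - z)" using N z by (intro mult_right_mono) auto
          then have z_min: "1 - z \<le> min y 1" using Nz z by simp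
          have xz: "0 \<le> x * z" "x * z \<le> x" using x z by (auto simp: mult_left_le)
          have "x - x * z = x * (1 - z)" by (simp add: algebra_simps)
          also have "\<dots> \<le> 1 - z" using x z by (intro mult_left_le_one_le) auto
          finally have x_xz: "x - x * z \<le> 1 - z" .
          \<comment> \<open>The increment form of the approximation is essential: its error is
            dominated by \<open>min y 1\<close>, whereas a constant error need not be
            \<nu>-integrable.\<close>
          have "p (x * z) - p x \<le> (Q (x * z) - Q x) + 1 / 2 * (x - x * z)"
          proof -
            have "x \<le> 1" using x by simp
            from abs_le_D2[OF a2[OF xz this]] show ?thesis unfolding p_def by linarith
          qed
          also have "Q (x * z) \<le> Q x * exp (g y)"
          proof -
            have "N * (x - x * z) \<le> N * (1 - z)" using N x_xz by (intro mult_left_mono) auto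
            then have le: "N * (x - x * z) \<le> y" using Nz by linarith
            have "N * (1 - x * z) = N * (1 - x) + N * (x - x * z)" by (simp add: algebra_simps)
            also have "g \<dots> \<le> g (N * (1 - x)) + g (N * (x - x * z))"
              using N x xz by (intro g_subadd) auto
            also have "g (N * (x - x * z)) \<le> g y" using N xz le by (intro g_mono) auto
            finally show ?thesis by (simp add: Q_def flip: exp_add)
          qed
          also have "1 / 2 * (x - x * z) \<le> Q x * min y 1"
          proof -
            have "1 / 2 * (x - x * z) \<le> 1 * min y 1"
              using order_trans[OF x_xz z_min] xz by simp
            also have "\<dots> \<le> Q x * min y 1" using Q1[OF x] y by (intro mult_right_mono) auto
            finally show ?thesis .
          qed
          finally show "p (x * exp (- y / N)) - p x \<le> Q x * ((exp (g y) - 1) + min y 1)"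
            by (simp add: z_def algebra_simps)
        qed
        also have "\<dots> = K * Q x"
          using K_int unfolding K_def by (simp only: integral_mult_right_zero mult.commute)
        finally show "(\<integral>y. p (x * exp (- y / N)) - p x \<partial>\<nu>) \<le> K * Q x" .
      qed
      also have "\<dots> = (b * \<beta> + b + K) * Q x" by (simp add: algebra_simps)
      also have "\<dots> \<le> (b * \<beta> + b + K) * (2 * p x)"
        using Q_le_p[OF x] K lam drift_nonneg by (intro mult_left_mono) auto
      finally show ?thesis by (simp add: C_def algebra_simps)
    qed
    have N0: "0 < N" using N by simp
    have int: "integrable (\<mu> t) (\<lambda>s. 2 * p (exp (- s / N)))"
      unfolding p_def using integral_exp_polynomial(1)[OF t N0] by (rule integrable_mult_right)
    have x: "exp (- s / N) \<in> {0..1}" if "0 \<le> s" for s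
      using that N by simp
    have "(\<integral>\<^sup>+s. ennreal (Q (exp (- s / N))) \<partial>\<mu> t) \<le> (\<integral>\<^sup>+s. ennreal (2 * p (exp (- s / N))) \<partial>\<mu> t)"
      by (intro nn_integral_mono_AE eventually_mono[OF nonneg[OF t]] ennreal_leI Q_le_p x)
    also have "\<dots> = ennreal (\<integral>s. 2 * p (exp (- s / N)) \<partial>\<mu> t)"
    proof (intro nn_integral_eq_integral int eventually_mono[OF nonneg[OF t]])
      fix s :: real assume "0 \<le> s"
      from Q_le_p[OF x[OF this]] Q1[OF x[OF this]] show "0 \<le> 2 * p (exp (- s / N))" by linarith
    qed
    \<comment> \<open>The initial value in the Gronwall bound is the coefficient sum, that is, Q 1 =
      1.\<close>
    also have "\<dots> \<le> ennreal (2 * exp (C * t))"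
      using gronwall_polynomial[OF N0 t gen[unfolded p_def]] \<open>Q 1 = 1\<close>
      by (intro ennreal_leI) (simp add: p_def a1)
    finally show ?thesis by (simp add: Q_def)
  qed

  show ?thesis
  \<comment> \<open>Here \<beta> is the cost of replacing the power by \<open>g\<close>, and 1
    covers the factor 2 \<le> exp 1.\<close>
  proof (rule that[of "\<beta> + 1 + C"])
    show "0 < \<beta> + 1 + C" using lam C by simp
    fix t :: real assume t: "0 \<le> t"
    note [measurable_cong] = sets_eq[OF t]
    have "(\<integral>\<^sup>+s. ennreal (exp (g s)) \<partial>\<mu> t) =
        (\<integral>\<^sup>+s. liminf (\<lambda>k. ennreal (exp (g (real (Suc k) * (1 - exp (- s / real (Suc k))))))) \<partial>\<mu> t)"
    proof (intro nn_integral_cong_AE eventually_mono[OF nonneg[OF t]])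
      fix s :: real assume s: "0 \<le> s"
      have "isCont (\<lambda>y. exp (g y)) s"
        unfolding g_def using s by (intro continuous_intros) auto
      from isCont_tendsto_compose[OF this LIMSEQ_scaled_one_minus_exp]
      show "ennreal (exp (g s)) = liminf (\<lambda>k. ennreal (exp (g (real (Suc k) * (1 - exp (- s / real (Suc k)))))))"
        by (intro lim_imp_Liminf[symmetric] tendsto_ennrealI) auto
    qed
    \<comment> \<open>Fatou's lemma along N = k + 1; the bound \<open>approx\<close> is uniform in
      N.\<close>
    also have "\<dots> \<le> liminf (\<lambda>k. \<integral>\<^sup>+s. ennreal (exp (g (real (Suc k) * (1 - exp (- s / real (Suc k)))))) \<partial>\<mu> t)"
      by (intro nn_integral_liminf) measurable
    also have "\<dots> \<le> liminf (\<lambda>k. ennreal (2 * exp (C * t)))"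
      using t by (intro Liminf_mono always_eventually allI approx) auto
    also have "\<dots> = ennreal (2 * exp (C * t))" by (simp add: Liminf_const)
    finally have fatou: "(\<integral>\<^sup>+s. ennreal (exp (g s)) \<partial>\<mu> t) \<le> ennreal (2 * exp (C * t))" .
    have "(\<integral>\<^sup>+s. ennreal (exp (\<beta> * s powr \<kappa>)) \<partial>\<mu> t) \<le> (\<integral>\<^sup>+s. ennreal (exp \<beta>) * ennreal (exp (g s)) \<partial>\<mu> t)"
      by (intro nn_integral_mono_AE eventually_mono[OF nonneg[OF t]])
         (use g_ge in \<open>simp flip: ennreal_mult exp_add\<close>)
    also have "\<dots> = ennreal (exp \<beta>) * (\<integral>\<^sup>+s. ennreal (exp (g s)) \<partial>\<mu> t)"
      by (intro nn_integral_cmult) measurable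
    also have "\<dots> \<le> ennreal (exp \<beta>) * ennreal (2 * exp (C * t))"
      by (rule mult_left_mono[OF fatou]) simp
    also have "\<dots> = ennreal (2 * exp (\<beta> + C * t))"
      by (simp add: exp_add mult.left_commute flip: ennreal_mult)
    also have "\<dots> \<le> ennreal (exp ((\<beta> + 1 + C) * max t 1))"
    proof (rule ennreal_leI)
      have "2 * exp (\<beta> + C * t) \<le> exp 1 * exp (\<beta> + C * t)"
        using exp_ge_add_one_self[of 1] by (intro mult_right_mono) auto
      also have "\<dots> = exp ((\<beta> + 1) * 1 + C * t)" by (simp add: ac_simps flip: exp_add)
      also have "\<dots> \<le> exp ((\<beta> + 1) * max t 1 + C * max t 1)"
        unfolding exp_le_cancel_iff using lam C by (intro add_mono mult_left_mono) auto
      finally show "2 * exp (\<beta> + C * t) \<le> exp ((\<beta> + 1 + C) * max t 1)" by (simp add: algebra_simps)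
    qed
    finally show "(\<integral>\<^sup>+s. ennreal (exp (\<beta> * s powr \<kappa>)) \<partial>\<mu> t) \<le> ennreal (exp ((\<beta> + 1 + C) * max t 1))"
      .
  qed
qed

end

subsection \<open>The subordinate semigroup\<close>

text \<open>This is the Hoelder inequality with exponents p and p / (p - 1), obtained by integrating
  the Young inequality for the normalised functions G / D and B / K.\<close>

lemma integral_powr_Hoelder:
  fixes F G \<Psi> :: "'b \<Rightarrow> real"
  assumes p: "1 < p"
    and F: "integrable M F" "AE s in M. 0 \<le> F s"
    and G: "integrable M G" "AE s in M. 0 \<le> G s"
    and [measurable]: "\<Psi> \<in> borel_measurable M"
    and le: "AE s in M. F s powr p \<le> G s * exp (\<Psi> s)"
    and K: "(\<integral>\<^sup>+s. ennreal (exp (\<Psi> s / (p - 1))) \<partial>M) \<le> ennreal K" "0 < K"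
  shows "(\<integral>s. F s \<partial>M) powr p \<le> (\<integral>s. G s \<partial>M) * K powr (p - 1)"
proof -
  define B where "B s = exp (\<Psi> s / (p - 1))" for s
  have B_int: "integrable M B"
    unfolding B_def using K(1) by (intro integrableI_nonneg) (auto intro: le_less_trans)
  have B_le: "(\<integral>s. B s \<partial>M) \<le> K"
  proof -
    have "(\<integral>\<^sup>+s. ennreal (B s) \<partial>M) = ennreal (\<integral>s. B s \<partial>M)"
      by (rule nn_integral_eq_integral[OF B_int]) (simp add: B_def)
    then show ?thesis using K by (simp flip: B_def)
  qed
  define J where "J = (\<integral>s. G s \<partial>M)"
  have J: "0 \<le> J" unfolding J_def using G(2) by (rule integral_nonneg_AE)
  have F_nonneg: "0 \<le> (\<integral>s. F s \<partial>M)" using F(2) by (rule integral_nonneg_AE)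
  \<comment> \<open>The integral of \<open>G\<close> may vanish, so it is enlarged by \<delta>
    before dividing; \<delta> tends to 0 at the end.\<close>
  have "(\<integral>s. F s \<partial>M) powr p \<le> (J + \<delta>) * K powr (p - 1)" if \<delta>: "0 < \<delta>" for \<delta>
  proof -
    define D where "D = J + \<delta>"
    have D: "0 < D" using J \<delta> by (simp add: D_def)
    \<comment> \<open>The Hoelder bound itself: its p-th power is D times K powr (p - 1).\<close>
    define L where "L = D powr (1 / p) * K powr (1 - 1 / p)"
    have L: "0 \<le> L" by (simp add: L_def)
    have pt: "F s \<le> L * (1 / p * (G s / D) + (1 - 1 / p) * (B s / K))"
      if s: "0 \<le> F s" "0 \<le> G s" "F s powr p \<le> G s * exp (\<Psi> s)" for s
    proof (cases "G s = 0")
      case True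
      then have "F s = 0" using s by simp
      then show ?thesis using True p K L by (simp add: B_def)
    next
      case False
      have "F s = (F s powr p) powr (1 / p)" using s p by (simp add: powr_powr)
      also have "\<dots> \<le> (G s * exp (\<Psi> s)) powr (1 / p)" using s p by (intro powr_mono2) auto
      also have "\<dots> = G s powr (1 / p) * B s powr (1 - 1 / p)"
      proof -
        have "\<Psi> s / (p - 1) * (1 - 1 / p) = \<Psi> s * (1 / p)" using p by (simp add: field_simps)
        then show ?thesis using s by (simp add: powr_mult B_def exp_powr_real)
      qed
      also have "\<dots> = L * ((G s / D) powr (1 / p) * (B s / K) powr (1 - 1 / p))"
        using D K s by (simp add: L_def powr_divide B_def)
      also have "\<dots> \<le> L * (1 / p * (G s / D) + (1 - 1 / p) * (B s / K))"
        using False s D K p L by (intro mult_left_mono Youngs_inequality_0) (auto simp: B_def)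
      finally show ?thesis .
    qed
    have "(\<integral>s. F s \<partial>M) \<le> (\<integral>s. L * (1 / p * (G s / D) + (1 - 1 / p) * (B s / K)) \<partial>M)"
    proof (rule integral_mono_AE[OF F(1)])
      show "integrable M (\<lambda>s. L * (1 / p * (G s / D) + (1 - 1 / p) * (B s / K)))"
        using G(1) B_int by simp
      show "AE s in M. F s \<le> L * (1 / p * (G s / D) + (1 - 1 / p) * (B s / K))"
        using F(2) G(2) le by eventually_elim (rule pt)
    qed
    also have "\<dots> = L * (1 / p * (J / D) + (1 - 1 / p) * ((\<integral>s. B s \<partial>M) / K))"
      using G(1) B_int by (simp add: J_def)
    also have "\<dots> \<le> L * (1 / p * 1 + (1 - 1 / p) * 1)"
      using L p D K B_le \<delta> by (intro mult_left_mono add_mono) (auto simp: D_def)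
    also have "\<dots> = L" by simp
    finally have "(\<integral>s. F s \<partial>M) powr p \<le> L powr p"
      using F_nonneg p by (intro powr_mono2) auto
    also have "L powr p = D * K powr (p - 1)"
      using p D K by (simp add: L_def powr_mult powr_powr left_diff_distrib)
    finally show ?thesis by (simp add: D_def)
  qed
  then have "(\<integral>s. F s \<partial>M) powr p / K powr (p - 1) \<le> J + \<delta>" if "0 < \<delta>" for \<delta>
    using that K by (simp add: pos_divide_le_eq)
  then have "(\<integral>s. F s \<partial>M) powr p / K powr (p - 1) \<le> J" by (rule field_le_epsilon)
  then show ?thesis using K by (simp add: J_def pos_divide_le_eq)
qed

section \<open>Integrability in time of the semigroup\<close>

context markov_semigroup
begin

lemma const_bounded_borel: "(\<lambda>_. c) \<in> bounded_borel"
  by (simp add: bounded_borel_def)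

text \<open>Positivity is applied to c - f, and P t fixes constants.\<close>

lemma le_const:
  assumes t: "0 \<le> t" and f: "f \<in> bounded_borel" "\<And>y. f y \<le> c"
  shows "P t f x \<le> c"
proof -
  have 1: "P t (\<lambda>y. c * 1 + (- 1) * f y) = (\<lambda>y. c * P t (\<lambda>_. 1) y + (- 1) * P t f y)"
    by (rule linear[OF t const_bounded_borel f(1)])
  have 2: "(\<lambda>y. c * 1 + (- 1) * f y) \<in> bounded_borel"
  proof -
    obtain d where d: "\<And>y. \<bar>f y\<bar> \<le> d"
      using f(1) unfolding bounded_borel_def bounded_iff by auto
    have "norm (c * 1 + (- 1) * f y) \<le> \<bar>c\<bar> + d" for y
      using d[of y] abs_triangle_ineq4[of c "f y"] by simp
    then have "bounded (range (\<lambda>y. c * 1 + (- 1) * f y))" unfolding bounded_iff by blast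
    moreover have "(\<lambda>y. c * 1 + (- 1) * f y) \<in> borel_measurable borel"
      using f(1) unfolding bounded_borel_def by (auto intro!: borel_measurable_diff)
    ultimately show ?thesis by (simp add: bounded_borel_def)
  qed
  have "0 \<le> P t (\<lambda>y. c * 1 + (- 1) * f y) x"
    using f(2) by (intro positive[OF t 2]) simp
  then show ?thesis unfolding 1 by (simp add: unital[OF t])
qed

text \<open>On the half-line P s f x lies between 0 and a bound of \<open>f\<close>; the indicator
  removes the negative times, at which P is unspecified.\<close>

lemma integrable_time:
  assumes "finite_measure \<mu>" "sets \<mu> = sets borel" and f: "f \<in> bounded_borel" "\<And>y. 0 \<le> f y"
  shows "integrable \<mu> (\<lambda>s. indicator {0..} s *\<^sub>R P s f x)"
proof -
  interpret finite_measure \<mu> by fact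
  obtain c where c: "\<And>y. \<bar>f y\<bar> \<le> c"
    using f(1) unfolding bounded_borel_def bounded_iff by auto
  have c': "f y \<le> c" for y using c[of y] by simp
  show ?thesis
  proof (rule integrable_const_bound[of _ c])
    show "AE s in \<mu>. norm (indicator {0..} s *\<^sub>R P s f x) \<le> c"
      using positive[OF _ f] le_const[OF _ f(1) c'] order_trans[OF f(2) c']
      by (intro always_eventually) (auto split: split_indicator)
    show "(\<lambda>s. indicator {0..} s *\<^sub>R P s f x) \<in> borel_measurable \<mu>"
      using time_measurable[OF f(1), of x] assms(2)
      by (simp add: set_borel_measurable_def cong: measurable_cong_sets)
  qed
qed

end

lemma bounded_borel_shift_powr:
  fixes f :: "'a::real_normed_vector \<Rightarrow> real"
  assumes f: "f \<in> bounded_borel" "\<And>y. 0 \<le> f y" and "0 \<le> p"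
  shows "(\<lambda>y. f (y + e) powr p) \<in> bounded_borel"
proof -
  have [measurable]: "f \<in> borel_measurable borel" using f(1) by (simp add: bounded_borel_def)
  have [measurable]: "(\<lambda>y. y + e) \<in> borel \<rightarrow>\<^sub>M borel"
    by (intro borel_measurable_continuous_onI continuous_intros)
  obtain c where c: "\<And>y. \<bar>f y\<bar> \<le> c"
    using f(1) unfolding bounded_borel_def bounded_iff by auto
  have "norm (f (y + e) powr p) \<le> c powr p" for y
    using f(2)[of "y + e"] c[of "y + e"] \<open>0 \<le> p\<close> by (simp add: powr_mono2)
  then have "bounded (range (\<lambda>y. f (y + e) powr p))" unfolding bounded_iff by blast
  moreover have "(\<lambda>y. f (y + e) powr p) \<in> borel_measurable borel" by measurable
  ultimately show ?thesis by (simp add: bounded_borel_def)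
qed

lemma subordinator_laplace_family:
  assumes "subordinator M S" "bernstein_function \<phi> b \<nu>" "laplace_exponent M S \<phi>"
  shows "laplace_family (\<lambda>t. distr M borel (S t)) \<phi> b \<nu>"
proof -
  interpret subordinator M S by fact
  show ?thesis
  proof (rule laplace_family.intro)
    show "bernstein_function \<phi> b \<nu>" by fact
    fix t :: real assume t: "0 \<le> t"
    note [measurable] = random_variable[OF t]
    show "prob_space (distr M borel (S t))" by (rule prob_space_distr) measurable
    show "sets (distr M borel (S t)) = sets borel" by simp
    have "AE \<omega> in M. 0 \<le> S t \<omega>"
      using start increasing by eventually_elim (use t in force)
    then show "AE s in distr M borel (S t). 0 \<le> s" by (subst AE_distr_iff) auto
    fix u :: real assume "0 < u"
    then show "(\<integral>s. exp (- u * s) \<partial>distr M borel (S t)) = exp (- t * \<phi> u)"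
      using assms(3) t by (subst integral_distr) (auto simp: laplace_exponent_def)
  qed
qed

text \<open>Quantifying \<open>C1\<close> and \<open>C2\<close> before \<open>P\<close>,
  \<open>x\<close> and all other variables expresses the claimed dependence: they are functions of
  the displayed parameters for a fixed subordinator. The values of the constants H at p and e appear
  as real arguments.\<close>

theorem theorem2p3:
  fixes M :: "'w measure" and S :: "real \<Rightarrow> 'w \<Rightarrow> real"
    and \<phi> :: "real \<Rightarrow> real" and b :: real and \<nu> :: "real measure"
  assumes "subordinator M S"
    and "bernstein_function \<phi> b \<nu>"
    and "laplace_exponent M S \<phi>"
  shows "\<exists>(C1 :: real \<Rightarrow> real \<Rightarrow> real \<Rightarrow> real \<Rightarrow> 'a::banach \<Rightarrow> real \<Rightarrow> real \<Rightarrow> real \<Rightarrow> real)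
          (C2 :: real \<Rightarrow> real \<Rightarrow> real \<Rightarrow> 'a \<Rightarrow> real \<Rightarrow> real \<Rightarrow> real \<Rightarrow> real).
    \<forall>(P :: real \<Rightarrow> ('a \<Rightarrow> real) \<Rightarrow> 'a \<Rightarrow> real) \<kappa>1 \<kappa>2 p x e H1 H2 H3 \<rho> r.
      markov_semigroup P \<longrightarrow>
      0 < \<kappa>1 \<longrightarrow> 0 < \<kappa>2 \<longrightarrow> \<kappa>2 \<le> 1 \<longrightarrow> 1 < p \<longrightarrow>
      0 \<le> H1 \<longrightarrow> 0 \<le> H2 \<longrightarrow> 0 \<le> H3 \<longrightarrow>
      shift_harnack P p x e (\<lambda>t. H1 / t powr \<kappa>1 + H2 * t powr \<kappa>2 + H3) \<longrightarrow>
      \<kappa>1 / (1 + \<kappa>1) < \<rho> \<longrightarrow> \<rho> \<le> rho_infty \<phi> \<longrightarrow>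
      0 < Liminf at_top (\<lambda>u. ereal (\<phi> u * u powr (- \<rho>))) \<longrightarrow>
      1 < r \<longrightarrow>
      (\<integral>\<^sup>+y\<in>{1..}. ennreal (exp (r * H2 / (p - 1) * y powr \<kappa>2)) \<partial>\<nu>) < \<infinity> \<longrightarrow>
      0 < C1 \<kappa>1 \<rho> p r e H1 H2 H3 \<and> 0 < C2 \<kappa>2 p r e H1 H2 H3 \<and>
      shift_harnack (subordinate M S P) p x e
        (\<lambda>t. C1 \<kappa>1 \<rho> p r e H1 H2 H3 / (min t 1) powr (\<kappa>1 / (\<rho> - (1 - \<rho>) * \<kappa>1))
            + C2 \<kappa>2 p r e H1 H2 H3 * max t 1 + H3)"
proof -
  define \<mu> where "\<mu> t = distr M borel (S t)" for t
  interpret laplace_family \<mu> \<phi> b \<nu>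
    unfolding \<mu>_def by (rule subordinator_laplace_family[OF assms])
  define good1 where "good1 \<kappa>1 \<rho> p r H1 C \<longleftrightarrow> 0 < C \<and>
    (\<forall>t>0. (\<integral>\<^sup>+s. ennreal (exp (r / (r - 1) * (H1 / (p - 1)) * s powr (- \<kappa>1))) \<partial>\<mu> t)
      \<le> ennreal (exp (C / min t 1 powr (\<kappa>1 / (\<rho> - (1 - \<rho>) * \<kappa>1)))))" for \<kappa>1 \<rho> p r H1 C :: real
  define good2 where "good2 \<kappa>2 p r H2 C \<longleftrightarrow> 0 < C \<and>
    (\<forall>t>0. (\<integral>\<^sup>+s. ennreal (exp (r * H2 / (p - 1) * s powr \<kappa>2)) \<partial>\<mu> t)
      \<le> ennreal (exp (C * max t 1)))" for \<kappa>2 p r H2 C :: real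
  \<comment> \<open>Choice turns existence for each parameter tuple into functions of the parameters
    alone, available before \<open>P\<close> and \<open>x\<close> are fixed.\<close>
  define D1 where "D1 \<kappa>1 \<rho> p r H1 = (SOME C. good1 \<kappa>1 \<rho> p r H1 C)" for \<kappa>1 \<rho> p r H1
  define D2 where "D2 \<kappa>2 p r H2 = (SOME C. good2 \<kappa>2 p r H2 C)" for \<kappa>2 p r H2
  show ?thesis
  \<comment> \<open>The factor p - 1 comes from the power of the moment in the Hoelder inequality;
    the 1 added to \<open>D2\<close> covers a factor 2.\<close>
  proof (intro exI[of _ "\<lambda>\<kappa>1 \<rho> p r e H1 H2 H3. (p - 1) * D1 \<kappa>1 \<rho> p r H1"]
      exI[of _ "\<lambda>\<kappa>2 p r e H1 H2 H3. (p - 1) * (D2 \<kappa>2 p r H2 + 1)"] allI impI)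
    fix P :: "real \<Rightarrow> ('a \<Rightarrow> real) \<Rightarrow> 'a \<Rightarrow> real" and \<kappa>1 \<kappa>2 p :: real and x e :: 'a and H1 H2 H3 \<rho> r :: real
    assume P: "markov_semigroup P"
      and \<kappa>: "0 < \<kappa>1" "0 < \<kappa>2" "\<kappa>2 \<le> 1" and p: "1 < p"
      and H: "0 \<le> H1" "0 \<le> H2" "0 \<le> H3"
      and harnack: "shift_harnack P p x e (\<lambda>t. H1 / t powr \<kappa>1 + H2 * t powr \<kappa>2 + H3)"
      and \<rho>: "\<kappa>1 / (1 + \<kappa>1) < \<rho>" "0 < Liminf at_top (\<lambda>u. ereal (\<phi> u * u powr (- \<rho>)))"
      and r: "1 < r"
      and levy: "(\<integral>\<^sup>+y\<in>{1..}. ennreal (exp (r * H2 / (p - 1) * y powr \<kappa>2)) \<partial>\<nu>) < \<infinity>"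
    interpret markov_semigroup P by fact
    define C1 where "C1 = D1 \<kappa>1 \<rho> p r H1"
    define C2 where "C2 = D2 \<kappa>2 p r H2"
    have "\<exists>C. good1 \<kappa>1 \<rho> p r H1 C"
      unfolding good1_def
      by (rule inverse_moment_bound[OF _ \<kappa>(1) \<rho>, of "r / (r - 1) * (H1 / (p - 1))"]) (use r p H in auto)
    then have C1: "good1 \<kappa>1 \<rho> p r H1 C1" unfolding C1_def D1_def by (rule someI_ex)
    have "\<exists>C. good2 \<kappa>2 p r H2 C"
      unfolding good2_def
      by (rule exponential_moment_bound[OF _ _ \<kappa>(3) levy]) (use r p H \<kappa> in auto)
    then have C2: "good2 \<kappa>2 p r H2 C2" unfolding C2_def D2_def by (rule someI_ex)
    have pos: "0 < C1" "0 < C2" using C1 C2 by (auto simp: good1_def good2_def)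
    have "shift_harnack (subordinate M S P) p x e
        (\<lambda>t. (p - 1) * C1 / (min t 1) powr (\<kappa>1 / (\<rho> - (1 - \<rho>) * \<kappa>1)) + (p - 1) * (C2 + 1) * max t 1 + H3)"
      unfolding shift_harnack_def
    proof (intro allI ballI impI)
      fix t :: real and f :: "'a \<Rightarrow> real"
      assume t: "0 < t" and f: "f \<in> bounded_borel" "\<forall>y. 0 \<le> f y"
      have t0: "0 \<le> t" using t by simp
      note [measurable_cong] = sets_eq[OF t0]
      interpret prob_space "\<mu> t" using prob t by simp
      define g where "g y = f (y + e) powr p" for y
      have g: "g \<in> bounded_borel" "0 \<le> g y" for y
        unfolding g_def using f p by (auto intro: bounded_borel_shift_powr)
      define \<Psi> where "\<Psi> s = H1 / s powr \<kappa>1 + H2 * s powr \<kappa>2 + H3" for s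
      define X where "X = C1 / min t 1 powr (\<kappa>1 / (\<rho> - (1 - \<rho>) * \<kappa>1))"
      define Y where "Y = C2 * max t 1"
      \<comment> \<open>The term max t 1 absorbs the factor 2 from adding two exponentials. The (p -
        1)-th power restores H3 exactly.\<close>
      define K where "K = exp (H3 / (p - 1) + (X + Y + max t 1))"
      have XY: "0 \<le> X" "0 \<le> Y" using pos by (simp_all add: X_def Y_def)
      have [measurable]: "\<Psi> \<in> borel_measurable (\<mu> t)" unfolding \<Psi>_def by measurable
      obtain c where c: "0 < c" "\<And>n. c * real (Suc n) powr \<rho> \<le> \<phi> (real (Suc n))"
        using bernstein_lower_bound[OF \<rho>(2) phi_pos] by blast
      have "0 < \<kappa>1 / (1 + \<kappa>1)" using \<kappa> by simp
      with \<rho> have "0 < \<rho>" by linarith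
      note AE_pos = AE_positive[OF t c(1) this c(2)]
      have "(\<integral>\<^sup>+s. ennreal (exp (\<Psi> s / (p - 1))) \<partial>\<mu> t) \<le> (\<integral>\<^sup>+s. ennreal (exp (H3 / (p - 1))) *
          (ennreal (exp (r / (r - 1) * (H1 / (p - 1)) * s powr (- \<kappa>1))) + ennreal (exp (r * H2 / (p - 1) * s powr \<kappa>2))) \<partial>\<mu> t)"
      proof (rule nn_integral_mono)
        fix s
        have "\<Psi> s / (p - 1) = H3 / (p - 1) + (H1 / (p - 1) * s powr (- \<kappa>1) + H2 / (p - 1) * s powr \<kappa>2)"
          by (simp add: \<Psi>_def powr_minus divide_inverse algebra_simps)
        then have "exp (\<Psi> s / (p - 1)) = exp (H3 / (p - 1)) * exp (H1 / (p - 1) * s powr (- \<kappa>1) + H2 / (p - 1) * s powr \<kappa>2)"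
          by (simp only: exp_add)
        \<comment> \<open>The factor r falls on the H2 term, exactly as in the hypothesis on \<nu>;
          the H1 term tolerates any finite factor.\<close>
        also have "\<dots> \<le> exp (H3 / (p - 1)) *
            (exp (r / (r - 1) * (H1 / (p - 1) * s powr (- \<kappa>1))) + exp (r * (H2 / (p - 1) * s powr \<kappa>2)))"
          by (intro mult_left_mono exp_add_le_conjugate r) simp
        finally have "ennreal (exp (\<Psi> s / (p - 1))) \<le> ennreal (exp (H3 / (p - 1)) *
            (exp (r / (r - 1) * (H1 / (p - 1) * s powr (- \<kappa>1))) + exp (r * (H2 / (p - 1) * s powr \<kappa>2))))"
          by (rule ennreal_leI)
        then show "ennreal (exp (\<Psi> s / (p - 1))) \<le> ennreal (exp (H3 / (p - 1))) *
          (ennreal (exp (r / (r - 1) * (H1 / (p - 1)) * s powr (- \<kappa>1))) + ennreal (exp (r * H2 / (p - 1) * s powr \<kappa>2)))"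
          by (simp add: ennreal_mult mult.assoc)
      qed
      also have "\<dots> = ennreal (exp (H3 / (p - 1))) *
          ((\<integral>\<^sup>+s. ennreal (exp (r / (r - 1) * (H1 / (p - 1)) * s powr (- \<kappa>1))) \<partial>\<mu> t) +
           (\<integral>\<^sup>+s. ennreal (exp (r * H2 / (p - 1) * s powr \<kappa>2)) \<partial>\<mu> t))"
        by (subst nn_integral_cmult, measurable, subst nn_integral_add) auto
      also have "\<dots> \<le> ennreal (exp (H3 / (p - 1))) * (ennreal (exp X) + ennreal (exp Y))"
        using C1 C2 t unfolding X_def Y_def good1_def good2_def by (intro mult_left_mono add_mono) auto
      also have "\<dots> = ennreal (exp (H3 / (p - 1)) * (exp X + exp Y))"
        by (simp add: ennreal_mult)
      also have "\<dots> \<le> ennreal K"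
      proof (rule ennreal_leI)
        have "exp X + exp Y \<le> exp (X + Y) + exp (X + Y)" using XY by (intro add_mono) auto
        also have "\<dots> \<le> exp 1 * exp (X + Y)"
          using exp_ge_add_one_self[of 1] mult_right_mono[of 2 "exp 1" "exp (X + Y)"] by simp
        also have "\<dots> \<le> exp (X + Y + max t 1)" by (simp flip: exp_add)
        finally have "exp (H3 / (p - 1)) * (exp X + exp Y) \<le> exp (H3 / (p - 1)) * exp (X + Y + max t 1)"
          by (rule mult_left_mono) simp
        then show "exp (H3 / (p - 1)) * (exp X + exp Y) \<le> K" by (simp add: K_def exp_add)
      qed
      finally have moment: "(\<integral>\<^sup>+s. ennreal (exp (\<Psi> s / (p - 1))) \<partial>\<mu> t) \<le> ennreal K" .
      have "(\<integral>s. indicator {0..} s *\<^sub>R P s f x \<partial>\<mu> t) powr p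
          \<le> (\<integral>s. indicator {0..} s *\<^sub>R P s g x \<partial>\<mu> t) * K powr (p - 1)"
      proof (rule integral_powr_Hoelder[OF p, where \<Psi> = \<Psi>])
        show "integrable (\<mu> t) (\<lambda>s. indicator {0..} s *\<^sub>R P s f x)"
          using f by (intro integrable_time finite_measure_axioms sets_eq t0) auto
        show "integrable (\<mu> t) (\<lambda>s. indicator {0..} s *\<^sub>R P s g x)"
          using g by (intro integrable_time finite_measure_axioms sets_eq t0) auto
        show "AE s in \<mu> t. 0 \<le> indicator {0..} s *\<^sub>R P s f x"
          using f by (intro always_eventually) (auto split: split_indicator intro: positive)
        show "AE s in \<mu> t. 0 \<le> indicator {0..} s *\<^sub>R P s g x"
          using g by (intro always_eventually) (auto split: split_indicator intro: positive)
        show "AE s in \<mu> t. (indicator {0..} s *\<^sub>R P s f x) powr p \<le> indicator {0..} s *\<^sub>R P s g x * exp (\<Psi> s)"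
          using AE_pos
        proof eventually_elim
          case (elim s)
          then show ?case
            using harnack f unfolding shift_harnack_def \<Psi>_def g_def by simp
        qed
      qed (use moment in \<open>auto simp: K_def\<close>)
      also have "K powr (p - 1) = exp ((p - 1) * C1 / (min t 1) powr (\<kappa>1 / (\<rho> - (1 - \<rho>) * \<kappa>1)) + (p - 1) * (C2 + 1) * max t 1 + H3)"
        using p by (simp add: K_def X_def Y_def exp_powr_real distrib_right distrib_left mult.commute)
      finally show "subordinate M S P t f x powr p \<le> subordinate M S P t (\<lambda>y. f (y + e) powr p) x *
          exp ((p - 1) * C1 / (min t 1) powr (\<kappa>1 / (\<rho> - (1 - \<rho>) * \<kappa>1)) + (p - 1) * (C2 + 1) * max t 1 + H3)"
        by (simp add: subordinate_def set_lebesgue_integral_def \<mu>_def g_def[abs_def])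
    qed
    then show "0 < (p - 1) * D1 \<kappa>1 \<rho> p r H1 \<and> 0 < (p - 1) * (D2 \<kappa>2 p r H2 + 1) \<and>
      shift_harnack (subordinate M S P) p x e
        (\<lambda>t. (p - 1) * D1 \<kappa>1 \<rho> p r H1 / (min t 1) powr (\<kappa>1 / (\<rho> - (1 - \<rho>) * \<kappa>1))
            + (p - 1) * (D2 \<kappa>2 p r H2 + 1) * max t 1 + H3)"
      using pos p by (simp add: C1_def C2_def)
  qed
qed

end
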